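(* Let $K$ be a field and let $\Lambda=K\mathcal{Q}/I$ be the Brauer configuration algebra associated to a connected and reduced Brauer configuration $\Gamma=(\Gamma_0,\Gamma_1,\mu,\mathfrak{o})$, where $\mathcal{Q}$ is the quiver of $\Gamma$. Then $$\dim_K Z(\Lambda)=1+\sum_{\alpha\in\Gamma_0}\mu(\alpha)+|\Gamma_1|-|\Gamma_0|+\#\mathrm{Loops}(\mathcal{Q})-|\mathcal{C}_\Gamma|,$$ where $Z(\Lambda)$ is the center of $\Lambda$, $\#\mathrm{Loops}(\mathcal{Q})$ is the number of loops in the quiver $\mathcal{Q}$, and $\mathcal{C}_\Gamma=\{\gamma\in\Gamma_0\mid \mathrm{val}(\gamma)=1\text{ and }\mu(\gamma)>1\}$.
   Context: Brauer configurations. Let $\Gamma_0$ be a finite set (of vertices), $\Gamma_1$ a finite labeled collection of finite multisets with elements in $\Gamma_0$ (polygons; repetitions allowed), and $\mu:\Gamma_0\to\mathbb{Z}_{>0}$ a function (multiplicity function). For $V\in\Gamma_1$, $\alpha\in\Gamma_0$, $\mathrm{occ}(\alpha,V)$ is the number of times $\alpha$ occurs in $V$, and $\mathrm{val}(\alpha)=\sum_{V\in\Gamma_1}\mathrm{occ}(\alpha,V)$. An orientation $\mathfrak{o}$ is a choice, for each vertex $\alpha$ with $\mathrm{val}(\alpha)>1$ or $\mu(\alpha)>1$, of a cyclic ordering $V_1<\cdots<V_t$ (then $V_t<V_1$), $t=\mathrm{val}(\alpha)$, of the list of polygons containing $\alpha$, each $V$ appearing $\mathrm{occ}(\alpha,V)$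 times; this is the successor sequence at $\alpha$. $\Gamma=(\Gamma_0,\Gamma_1,\mu,\mathfrak{o})$ is a Brauer configuration if (C1) every vertex occurs in some polygon; (C2) every polygon has at least two vertices (counted with repetition); (C3) every polygon contains a vertex $\alpha$ with $\mathrm{val}(\alpha)\mu(\alpha)>1$. The set of truncated vertices is $\mathcal{T}_\Gamma=\{\alpha\in\Gamma_0\mid\mu(\alpha)\mathrm{val}(\alpha)=1\}$. $\Gamma$ is connected if $\Gamma_1\neq\emptyset$ and $\Gamma_1$ cannot be partitioned into two nonempty subcollections such that no vertex occurs in polygons of both. A polygon is a $d$-gon if it has $d$ vertices counted with repetition. $\Gamma$ is reduced if every polygon $V$ either contains no truncated vertex, or is a $2$-gon with only one truncated vertex. Quiver. $\mathcal{Q}=\mathcal{Q}_\Gamma$ has one vertex $v$ for each polygon $V$. For each $\alpha\in\Gamma_0\setminus\mathcal{T}_\Gamma$ with successor sequence $V_1<\cdots<V_t$, $t=\mathrm{val}(\alpha)$, there are arrows $a^{(\alpha)}_i:v_i\to v_{i+1}$, $1\le i\le t$ (with $v_{t+1}=v_1$); arrows for different pairs $(\alpha,i)$ are distinct, and these are all arrows. (If $\mathrm{val}(\alpha)=1$, $\mu(\alpha)>1$, this gives one loop.) Paths are written left to right. The special $\alpha$-cycles are $C_l=a^{(\alpha)}_l\cdots a^{(\alpha)}_t a^{(\alpha)}_1\cdots a^{(\alpha)}_{l-1}$, $1\le l\le t$; $C_l$ is a special $\alpha$-cycle at $v$ if $V_l=V$. $\mathcal{C}^{v}_{(\alpha)}$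 is the set of special $\alpha$-cycles at $v$, $\mathcal{CC}_{(\alpha)}$ the set of all special $\alpha$-cycles, and $f(C)$ is the first arrow of a special cycle $C$. Algebra. The Brauer configuration algebra of $\Gamma$ over $K$ is $\Lambda=K\mathcal{Q}/I$, with $I$ the ideal generated by: (type one) $C^{\mu(\alpha)}-D^{\mu(\beta)}$ for all polygons $V$, nontruncated $\alpha,\beta\in V$ (possibly equal), $C\in\mathcal{C}^v_{(\alpha)}$, $D\in\mathcal{C}^v_{(\beta)}$; (type two) $C^{\mu(\alpha)}f(C)$ for all $\alpha\in\Gamma_0\setminus\mathcal{T}_\Gamma$, $C\in\mathcal{CC}_{(\alpha)}$; (type three) all paths $ab$ of length two ($a,b$ arrows) that are not a subpath of any special cycle, except $ab=a^2$ when $a=b$ is the loop arising from a vertex $\alpha$ with $\mathrm{val}(\alpha)=1$ and $\mu(\alpha)>1$. *)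

theory Defs
  imports
    "Graph_Theory.Arc_Walk"
    "HOL-Algebra.QuotRing"
    "HOL-Library.Sublist"
    "Jordan_Normal_Form.VS_Connect"
begin

section \<open>Brauer configurations\<close>

text \<open>
  The polygons form a \<^emph>\<open>labeled\<close> collection of multisets: \<open>bc_polys\<close> is the set of labels,
  and distinct labels may carry the same multiset \<open>bc_mset V\<close>.
  The cyclic ordering at a vertex is given by a list \<open>bc_succ \<alpha> = [V\<^sub>1, \<dots>, V\<^sub>t]\<close>, that is, by
  the cyclic ordering cut open at some place; the values at truncated vertices are irrelevant.
\<close>

record ('v, 'p) brauer_config =
  bc_verts :: "'v set"
  bc_polys :: "'p set"
  bc_mset :: "'p \<Rightarrow> 'v multiset"
  bc_mu :: "'v \<Rightarrow> nat"
  bc_succ :: "'v \<Rightarrow> 'p list"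

definition occ :: "('v, 'p) brauer_config \<Rightarrow> 'v \<Rightarrow> 'p \<Rightarrow> nat" where
  "occ \<Gamma> \<alpha> V = count (bc_mset \<Gamma> V) \<alpha>"

definition val :: "('v, 'p) brauer_config \<Rightarrow> 'v \<Rightarrow> nat" where
  "val \<Gamma> \<alpha> = (\<Sum>V\<in>bc_polys \<Gamma>. occ \<Gamma> \<alpha> V)"

definition truncated :: "('v, 'p) brauer_config \<Rightarrow> 'v set" where
  "truncated \<Gamma> = {\<alpha> \<in> bc_verts \<Gamma>. bc_mu \<Gamma> \<alpha> * val \<Gamma> \<alpha> = 1}"

locale brauer_configuration =
  fixes \<Gamma> :: "('v, 'p) brauer_config"
  assumes finite_verts: "finite (bc_verts \<Gamma>)"
    and finite_polys: "finite (bc_polys \<Gamma>)"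
    and polys_verts: "V \<in> bc_polys \<Gamma> \<Longrightarrow> set_mset (bc_mset \<Gamma> V) \<subseteq> bc_verts \<Gamma>"
    and mu_pos: "\<alpha> \<in> bc_verts \<Gamma> \<Longrightarrow> bc_mu \<Gamma> \<alpha> > 0"
    and orientation: "\<alpha> \<in> bc_verts \<Gamma> \<Longrightarrow> val \<Gamma> \<alpha> > 1 \<or> bc_mu \<Gamma> \<alpha> > 1 \<Longrightarrow>
      count (mset (bc_succ \<Gamma> \<alpha>)) V = (if V \<in> bc_polys \<Gamma> then occ \<Gamma> \<alpha> V else 0)"
    and C1: "\<alpha> \<in> bc_verts \<Gamma> \<Longrightarrow> \<exists>V\<in>bc_polys \<Gamma>. \<alpha> \<in># bc_mset \<Gamma> V"
    and C2: "V \<in> bc_polys \<Gamma> \<Longrightarrow> size (bc_mset \<Gamma> V) \<ge> 2"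
    and C3: "V \<in> bc_polys \<Gamma> \<Longrightarrow> \<exists>\<alpha>. \<alpha> \<in># bc_mset \<Gamma> V \<and> val \<Gamma> \<alpha> * bc_mu \<Gamma> \<alpha> > 1"

definition bc_connected :: "('v, 'p) brauer_config \<Rightarrow> bool" where
  "bc_connected \<Gamma> \<longleftrightarrow> bc_polys \<Gamma> \<noteq> {} \<and>
    \<not> (\<exists>A B. A \<noteq> {} \<and> B \<noteq> {} \<and> A \<inter> B = {} \<and> A \<union> B = bc_polys \<Gamma> \<and>
         \<not> (\<exists>\<alpha>. \<exists>V\<in>A. \<exists>W\<in>B. \<alpha> \<in># bc_mset \<Gamma> V \<and> \<alpha> \<in># bc_mset \<Gamma> W))"

definition bc_reduced :: "('v, 'p) brauer_config \<Rightarrow> bool" where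
  "bc_reduced \<Gamma> \<longleftrightarrow> (\<forall>V\<in>bc_polys \<Gamma>.
     (\<forall>\<alpha>. \<alpha> \<in># bc_mset \<Gamma> V \<longrightarrow> \<alpha> \<notin> truncated \<Gamma>) \<or>
     (size (bc_mset \<Gamma> V) = 2 \<and> size {#\<alpha> \<in># bc_mset \<Gamma> V. \<alpha> \<in> truncated \<Gamma>#} = 1))"


section \<open>The quiver of a Brauer configuration\<close>

text \<open>
  A quiver is a \<open>pre_digraph\<close> (loops and parallel arcs are allowed there). The arrow
  \<open>a\<^sub>i\<close> belonging to \<open>\<alpha>\<close> is the pair \<open>(\<alpha>, i - 1)\<close>, that is, positions are counted from 0.
\<close>

definition bc_quiver :: "('v, 'p) brauer_config \<Rightarrow> ('p, 'v \<times> nat) pre_digraph" where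
  "bc_quiver \<Gamma> = \<lparr>
     verts = bc_polys \<Gamma>,
     arcs = {(\<alpha>, i). \<alpha> \<in> bc_verts \<Gamma> - truncated \<Gamma> \<and> i < val \<Gamma> \<alpha>},
     tail = (\<lambda>(\<alpha>, i). bc_succ \<Gamma> \<alpha> ! i),
     head = (\<lambda>(\<alpha>, i). bc_succ \<Gamma> \<alpha> ! (Suc i mod val \<Gamma> \<alpha>))\<rparr>"

definition quiver_loops :: "('q, 'a) pre_digraph \<Rightarrow> 'a set" where
  "quiver_loops Q = {a \<in> arcs Q. tail Q a = head Q a}"

definition special_cycle :: "('v, 'p) brauer_config \<Rightarrow> 'v \<Rightarrow> nat \<Rightarrow> ('v \<times> nat) list" where
  "special_cycle \<Gamma> \<alpha> l = rotate l (map (Pair \<alpha>) [0..<val \<Gamma> \<alpha>])"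

definition special_cycles :: "('v, 'p) brauer_config \<Rightarrow> 'v \<Rightarrow> ('v \<times> nat) list set" where
  "special_cycles \<Gamma> \<alpha> = {special_cycle \<Gamma> \<alpha> l | l. l < val \<Gamma> \<alpha>}"

definition special_cycles_at :: "('v, 'p) brauer_config \<Rightarrow> 'v \<Rightarrow> 'p \<Rightarrow> ('v \<times> nat) list set" where
  "special_cycles_at \<Gamma> \<alpha> V = {special_cycle \<Gamma> \<alpha> l | l. l < val \<Gamma> \<alpha> \<and> bc_succ \<Gamma> \<alpha> ! l = V}"


section \<open>Path algebras\<close>

text \<open>
  A path is a triple (source, arrows from left to right, target), the trivial path at \<open>u\<close>
  being \<open>(u, [], u)\<close>. Elements of the path algebra are the finitely supported functions from
  paths to the field. In the product, the set of factorizations of a path \<open>r\<close> summed over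
  is always finite.
\<close>

type_synonym ('q, 'a) path = "'q \<times> 'a list \<times> 'q"

definition quiver_paths :: "('q, 'a) pre_digraph \<Rightarrow> ('q, 'a) path set" where
  "quiver_paths Q = {(u, as, v). pre_digraph.awalk Q u as v}"

definition path_factorizations ::
    "('q, 'a) pre_digraph \<Rightarrow> ('q, 'a) path \<Rightarrow> (('q, 'a) path \<times> ('q, 'a) path) set" where
  "path_factorizations Q r =
     {((u, as, v), (v', bs, w)) | u as v v' bs w.
        (u, as, v) \<in> quiver_paths Q \<and> (v', bs, w) \<in> quiver_paths Q \<and> v = v' \<and>
        r = (u, as @ bs, w)}"

definition path_algebra ::
    "('q, 'a) pre_digraph \<Rightarrow> ('k::field, ('q, 'a) path \<Rightarrow> 'k) module" where
  "path_algebra Q = \<lparr>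
     carrier = {f. finite {p. f p \<noteq> 0} \<and> {p. f p \<noteq> 0} \<subseteq> quiver_paths Q},
     mult = (\<lambda>f g r. \<Sum>(p, q)\<in>path_factorizations Q r. f p * g q),
     one = (\<lambda>p. if p \<in> {(v, [], v) | v. v \<in> verts Q} then 1 else 0),
     zero = (\<lambda>p. 0),
     add = (\<lambda>f g p. f p + g p),
     smult = (\<lambda>c f p. c * f p)\<rparr>"

definition path_elem :: "('q, 'a) path \<Rightarrow> ('q, 'a) path \<Rightarrow> 'k::field" where
  "path_elem p = (\<lambda>q. if q = p then 1 else 0)"

text \<open>The element of the path algebra given by a nonempty list of composable arrows.\<close>

definition arrows_elem :: "('q, 'a) pre_digraph \<Rightarrow> 'a list \<Rightarrow> ('q, 'a) path \<Rightarrow> 'k::field" where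
  "arrows_elem Q as = path_elem (tail Q (hd as), as, head Q (last as))"


section \<open>Quotient algebras and centers\<close>

text \<open>
  The quotient ring by an ideal, with the scalar multiplication induced on cosets:
  the union below is the single coset of \<open>c \<odot> x\<close> for any \<open>x \<in> X\<close>.
\<close>

definition quot_algebra :: "('k, 'b) module \<Rightarrow> 'b set \<Rightarrow> ('k, 'b set) module" where
  "quot_algebra A I = \<lparr>
     carrier = carrier (A Quot I),
     mult = mult (A Quot I),
     one = one (A Quot I),
     zero = zero (A Quot I),
     add = add (A Quot I),
     smult = (\<lambda>c X. \<Union>x\<in>X. I +>\<^bsub>A\<^esub> (c \<odot>\<^bsub>A\<^esub> x))\<rparr>"

definition ring_center :: "('a, 'b) ring_scheme \<Rightarrow> 'a set" where
  "ring_center R = {z \<in> carrier R. \<forall>x\<in>carrier R. z \<otimes>\<^bsub>R\<^esub> x = x \<otimes>\<^bsub>R\<^esub> z}"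

definition center_space :: "('k, 'b) module \<Rightarrow> ('k, 'b) module" where
  "center_space A = A\<lparr>carrier := ring_center A\<rparr>"


section \<open>Brauer configuration algebras\<close>

definition cycle_power :: "'a list \<Rightarrow> nat \<Rightarrow> 'a list" where
  "cycle_power C n = concat (replicate n C)"

definition relations_one ::
    "('v, 'p) brauer_config \<Rightarrow> (('p, 'v \<times> nat) path \<Rightarrow> 'k::field) set" where
  "relations_one \<Gamma> =
     {arrows_elem (bc_quiver \<Gamma>) (cycle_power C (bc_mu \<Gamma> \<alpha>))
        \<ominus>\<^bsub>path_algebra (bc_quiver \<Gamma>)\<^esub> arrows_elem (bc_quiver \<Gamma>) (cycle_power D (bc_mu \<Gamma> \<beta>))
      | V \<alpha> \<beta> C D. V \<in> bc_polys \<Gamma> \<and>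
          \<alpha> \<in># bc_mset \<Gamma> V \<and> \<alpha> \<notin> truncated \<Gamma> \<and> \<beta> \<in># bc_mset \<Gamma> V \<and> \<beta> \<notin> truncated \<Gamma> \<and>
          C \<in> special_cycles_at \<Gamma> \<alpha> V \<and> D \<in> special_cycles_at \<Gamma> \<beta> V}"

definition relations_two ::
    "('v, 'p) brauer_config \<Rightarrow> (('p, 'v \<times> nat) path \<Rightarrow> 'k::field) set" where
  "relations_two \<Gamma> =
     {arrows_elem (bc_quiver \<Gamma>) (cycle_power C (bc_mu \<Gamma> \<alpha>) @ [hd C])
      | \<alpha> C. \<alpha> \<in> bc_verts \<Gamma> - truncated \<Gamma> \<and> C \<in> special_cycles \<Gamma> \<alpha>}"

definition relations_three ::
    "('v, 'p) brauer_config \<Rightarrow> (('p, 'v \<times> nat) path \<Rightarrow> 'k::field) set" where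
  "relations_three \<Gamma> =
     {arrows_elem (bc_quiver \<Gamma>) [a, b]
      | a b. a \<in> arcs (bc_quiver \<Gamma>) \<and> b \<in> arcs (bc_quiver \<Gamma>) \<and>
          head (bc_quiver \<Gamma>) a = tail (bc_quiver \<Gamma>) b \<and>
          \<not> (\<exists>\<alpha> \<in> bc_verts \<Gamma> - truncated \<Gamma>. \<exists>C \<in> special_cycles \<Gamma> \<alpha>. sublist [a, b] C) \<and>
          \<not> (a = b \<and> val \<Gamma> (fst a) = 1 \<and> bc_mu \<Gamma> (fst a) > 1)}"

definition bc_ideal ::
    "('v, 'p) brauer_config \<Rightarrow> (('p, 'v \<times> nat) path \<Rightarrow> 'k::field) set" where
  "bc_ideal \<Gamma> = Idl\<^bsub>path_algebra (bc_quiver \<Gamma>)\<^esub>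
     (relations_one \<Gamma> \<union> relations_two \<Gamma> \<union> relations_three \<Gamma>)"

definition brauer_algebra ::
    "('v, 'p) brauer_config \<Rightarrow> ('k::field, (('p, 'v \<times> nat) path \<Rightarrow> 'k) set) module" where
  "brauer_algebra \<Gamma> = quot_algebra (path_algebra (bc_quiver \<Gamma>)) (bc_ideal \<Gamma>)"

end

theory Submission
  imports Defs
begin

text \<open>
  Modulo the relations, a path survives only if it runs along the successor sequence of one
  nontruncated vertex \<open>\<alpha>\<close> and is not longer than \<open>\<mu>(\<alpha>)\<close> full turns, and all paths of maximal length
  that start at the same polygon are identified. So an element of the path algebra should be
  determined in the quotient by its coordinates: its coefficients at the shorter paths of this kind,
  trivial paths included, and, for every polygon \<open>V\<close>, the sum of its coefficients at the maximal
  paths that start at \<open>V\<close>. Lemma \<open>bc_ideal_eq_coordinate_kernel\<close> makes this precise without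
  choosing a basis: the ideal of relations is the common kernel of these functionals. Indeed the
  kernel is an ideal that contains the relations, by the formula \<open>mult_cyclic_path\<close> for the
  coefficients of a product; conversely an element of the kernel is a combination of paths that
  contain a relation and of differences of maximal paths with the same start.

  In these coordinates four kinds of elements are seen to be central: the unit; for every \<open>\<alpha>\<close> and
  \<open>0 < k < \<mu>(\<alpha>)\<close> the sum of the \<open>k\<close>-th powers of the special \<open>\<alpha>\<close>-cycles; for every polygon a
  maximal path that starts there; and for every loop \<open>a\<close> that belongs to a vertex of valency greater
  than one the path \<open>p\<close> for which \<open>a p\<close> and \<open>p a\<close> are maximal. Each of them has a coordinate that
  is one on it and zero on the others. Conversely, let these selected coordinates of a central \<open>z\<close>
  all vanish. Comparing \<open>z a\<close> with \<open>a z\<close> for arrows and trivial paths \<open>a\<close> relates every other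
  coordinate of \<open>z\<close> to a selected one or forces it to be zero; connectedness enters where the
  coefficients of all trivial paths are shown to agree. Hence \<open>z\<close> is zero
  (\<open>center_coord_separating\<close>), the four kinds of elements form a basis of the center, and it
  remains to count them: there are \<open>1\<close>, \<open>\<Sum>\<^sub>\<alpha> (\<mu>(\<alpha>) - 1)\<close>, \<open>|\<Gamma>\<^sub>1|\<close>, and as many as
  there are loops that do not belong to a vertex in \<open>\<C>\<^sub>\<Gamma>\<close>.
\<close>

section \<open>Path algebras\<close>

lemma class_cring: "cring (class_ring :: 'k::field ring)"
  by (rule domain.axioms(1)[OF field.axioms(1)[OF class_field]])

locale finite_vertex_quiver = wf_digraph Q for Q :: "('q, 'a) pre_digraph" +
  assumes finite_vertices: "finite (verts Q)"

text \<open>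
  Only composable paths have a meaningful product; composability of the factors is a separate
  condition in \<open>path_factorizations_iff\<close>.
\<close>

fun path_concat :: "('q, 'a) path \<Rightarrow> ('q, 'a) path \<Rightarrow> ('q, 'a) path" where
  "path_concat (u, as, v) (v', bs, w) = (u, as @ bs, w)"

lemma path_concat_simps [simp]:
  "fst (path_concat p q) = fst p"
  "fst (snd (path_concat p q)) = fst (snd p) @ fst (snd q)"
  "snd (snd (path_concat p q)) = snd (snd q)"
  by (cases p; cases q; simp)+

lemma path_concat_assoc:
  "path_concat (path_concat p q) r = path_concat p (path_concat q r)"
  by (cases p; cases q; cases r) simp

lemma path_factorizations_iff:
  "(p, q) \<in> path_factorizations Q r \<longleftrightarrow>
     p \<in> quiver_paths Q \<and> q \<in> quiver_paths Q \<and> snd (snd p) = fst q \<and> r = path_concat p q"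
  by (cases p; cases q; auto simp: path_factorizations_def)

lemma path_algebra_simps:
  "carrier (path_algebra Q) = {f. finite {p. f p \<noteq> 0} \<and> {p. f p \<noteq> 0} \<subseteq> quiver_paths Q}"
  "(f \<otimes>\<^bsub>path_algebra Q\<^esub> g) r = (\<Sum>(p, q)\<in>path_factorizations Q r. f p * g q)"
  "\<one>\<^bsub>path_algebra Q\<^esub> = (\<lambda>p. if p \<in> {(v, [], v) | v. v \<in> verts Q} then 1 else 0)"
  "\<zero>\<^bsub>path_algebra Q\<^esub> = (\<lambda>p. 0)"
  "f \<oplus>\<^bsub>path_algebra Q\<^esub> g = (\<lambda>p. f p + g p)"
  "c \<odot>\<^bsub>path_algebra Q\<^esub> f = (\<lambda>p. c * f p)"
  by (simp_all add: path_algebra_def)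

context finite_vertex_quiver
begin

abbreviation "A \<equiv> path_algebra Q"

lemma quiver_paths_iff: "(u, as, v) \<in> quiver_paths Q \<longleftrightarrow> awalk u as v"
  by (simp add: quiver_paths_def)

lemma quiver_paths_concat:
  "p \<in> quiver_paths Q \<Longrightarrow> q \<in> quiver_paths Q \<Longrightarrow> snd (snd p) = fst q \<Longrightarrow>
    path_concat p q \<in> quiver_paths Q"
  by (cases p; cases q) (auto simp: quiver_paths_iff awalk_append_iff awlast_if_cas)

lemma quiver_paths_append:
  "(u, as, v) \<in> quiver_paths Q \<Longrightarrow> (v, bs, w) \<in> quiver_paths Q \<Longrightarrow> (u, as @ bs, w) \<in> quiver_paths Q"
  by (simp add: quiver_paths_iff)

lemma finite_path_factorizations [simp]: "finite (path_factorizations Q r)"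
proof -
  obtain u cs w where r: "r = (u, cs, w)" by (cases r) auto
  have "path_factorizations Q r \<subseteq>
    (\<lambda>(k, v). ((u, take k cs, v), (v, drop k cs, w))) ` ({..length cs} \<times> verts Q)"
  proof
    fix x assume "x \<in> path_factorizations Q r"
    then obtain as v bs where x: "x = ((u, as, v), (v, bs, w))" and c: "cs = as @ bs"
      and a: "awalk u as v" "awalk v bs w"
      by (auto simp: path_factorizations_def r quiver_paths_iff)
    have "v \<in> verts Q" using a(2) by (rule awalk_hd_in_verts)
    then show "x \<in> (\<lambda>(k, v). ((u, take k cs, v), (v, drop k cs, w))) ` ({..length cs} \<times> verts Q)"
      using c x by (intro image_eqI[of _ _ "(length as, v)"]) auto
  qed
  then show ?thesis by (rule finite_subset) (simp add: finite_vertices)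
qed

lemma path_algebra_eval_outside: "f \<in> carrier A \<Longrightarrow> p \<notin> quiver_paths Q \<Longrightarrow> f p = 0"
  by (auto simp: path_algebra_simps)

lemma path_algebra_mult_closed:
  assumes f: "f \<in> carrier A" and g: "g \<in> carrier A"
  shows "f \<otimes>\<^bsub>A\<^esub> g \<in> carrier A"
proof -
  have *: "\<exists>p q. f p \<noteq> 0 \<and> g q \<noteq> 0 \<and> (p, q) \<in> path_factorizations Q r"
    if nonzero: "(f \<otimes>\<^bsub>A\<^esub> g) r \<noteq> 0" for r
  proof -
    obtain x where "x \<in> path_factorizations Q r" "(case x of (p, q) \<Rightarrow> f p * g q) \<noteq> 0"
      by (rule sum.not_neutral_contains_not_neutral[OF nonzero[unfolded path_algebra_simps]])
    then show ?thesis by (intro exI[of _ "fst x"] exI[of _ "snd x"]) (auto simp: case_prod_unfold)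
  qed
  have "{r. (f \<otimes>\<^bsub>A\<^esub> g) r \<noteq> 0} \<subseteq> (\<lambda>(p, q). path_concat p q) ` ({p. f p \<noteq> 0} \<times> {q. g q \<noteq> 0})"
  proof
    fix r assume "r \<in> {r. (f \<otimes>\<^bsub>A\<^esub> g) r \<noteq> 0}"
    then obtain p q where "f p \<noteq> 0" "g q \<noteq> 0" "r = path_concat p q"
      using *[of r] unfolding path_factorizations_iff by blast
    then show "r \<in> (\<lambda>(p, q). path_concat p q) ` ({p. f p \<noteq> 0} \<times> {q. g q \<noteq> 0})"
      by (intro image_eqI[of _ _ "(p, q)"]) simp_all
  qed
  moreover have "finite ({p. f p \<noteq> 0} \<times> {q. g q \<noteq> 0})"
    using f g by (simp add: path_algebra_simps)
  ultimately have "finite {r. (f \<otimes>\<^bsub>A\<^esub> g) r \<noteq> 0}"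
    by (meson finite_imageI finite_subset)
  moreover have "r \<in> quiver_paths Q" if "(f \<otimes>\<^bsub>A\<^esub> g) r \<noteq> 0" for r
    using *[OF that] quiver_paths_concat unfolding path_factorizations_iff by blast
  ultimately show ?thesis unfolding path_algebra_simps(1) by blast
qed

lemma path_algebra_one_closed: "\<one>\<^bsub>A\<^esub> \<in> carrier (A :: ('k::field, _) module)"
proof -
  have "{p. \<one>\<^bsub>A\<^esub> p \<noteq> (0::'k)} = (\<lambda>v. (v, [], v)) ` verts Q"
    by (auto simp: path_algebra_simps)
  moreover have "(\<lambda>v. (v, [], v)) ` verts Q \<subseteq> quiver_paths Q"
    by (auto simp: quiver_paths_iff awalk_Nil_iff)
  ultimately show ?thesis
    unfolding path_algebra_simps(1) using finite_vertices by simp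
qed

lemma path_algebra_add_closed:
  assumes "f \<in> carrier A" "g \<in> carrier A"
  shows "f \<oplus>\<^bsub>A\<^esub> g \<in> carrier A"
proof -
  have "{p. f p + g p \<noteq> 0} \<subseteq> {p. f p \<noteq> 0} \<union> {p. g p \<noteq> 0}" by auto
  with assms show ?thesis
    by (auto simp: path_algebra_simps intro: finite_subset)
qed

lemma path_algebra_smult_closed: "f \<in> carrier A \<Longrightarrow> c \<odot>\<^bsub>A\<^esub> f \<in> carrier A"
  by (cases "c = 0") (auto simp: path_algebra_simps)

text \<open>
  Both bracketings sum over the factorizations of a path into three paths: those where the first
  of two factors is factorized again correspond to those where the second one is.
\<close>

lemma path_algebra_mult_assoc: "(f \<otimes>\<^bsub>A\<^esub> g) \<otimes>\<^bsub>A\<^esub> h = f \<otimes>\<^bsub>A\<^esub> (g \<otimes>\<^bsub>A\<^esub> h)"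
proof
  fix r
  let ?F = "path_factorizations Q"
  have "((f \<otimes>\<^bsub>A\<^esub> g) \<otimes>\<^bsub>A\<^esub> h) r = (\<Sum>x\<in>?F r. \<Sum>y\<in>?F (fst x). f (fst y) * g (snd y) * h (snd x))"
    by (simp add: path_algebra_simps case_prod_unfold sum_distrib_right)
  also have "\<dots> = (\<Sum>(x, y)\<in>(SIGMA x:?F r. ?F (fst x)). f (fst y) * g (snd y) * h (snd x))"
    by (subst sum.Sigma) auto
  also have "\<dots> = (\<Sum>(x, y)\<in>(SIGMA x:?F r. ?F (snd x)). f (fst x) * g (fst y) * h (snd y))"
    by (rule sum.reindex_bij_witness[where
          i = "\<lambda>(x, y). ((path_concat (fst x) (fst y), snd y), (fst x, fst y))" and
          j = "\<lambda>(x, y). ((fst y, path_concat (snd y) (snd x)), (snd y, snd x))"])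
       (auto simp: path_factorizations_iff path_concat_assoc quiver_paths_append)
  also have "\<dots> = (\<Sum>x\<in>?F r. \<Sum>y\<in>?F (snd x). f (fst x) * g (fst y) * h (snd y))"
    by (subst sum.Sigma) auto
  also have "\<dots> = (f \<otimes>\<^bsub>A\<^esub> (g \<otimes>\<^bsub>A\<^esub> h)) r"
    by (simp add: path_algebra_simps case_prod_unfold sum_distrib_left mult.assoc)
  finally show "((f \<otimes>\<^bsub>A\<^esub> g) \<otimes>\<^bsub>A\<^esub> h) r = (f \<otimes>\<^bsub>A\<^esub> (g \<otimes>\<^bsub>A\<^esub> h)) r" .
qed

lemma path_algebra_l_one:
  assumes f: "f \<in> carrier A" shows "\<one>\<^bsub>A\<^esub> \<otimes>\<^bsub>A\<^esub> f = f"
proof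
  fix r :: "('q, 'a) path"
  obtain u as v where r: "r = (u, as, v)" by (cases r) auto
  show "(\<one>\<^bsub>A\<^esub> \<otimes>\<^bsub>A\<^esub> f) r = f r"
  proof (cases "r \<in> quiver_paths Q")
    case False
    then have "path_factorizations Q r = {}"
      by (auto simp: path_factorizations_iff quiver_paths_append)
    with False f show ?thesis by (simp add: path_algebra_simps(2) path_algebra_eval_outside)
  next
    case True
    then have u: "awalk u as v" "u \<in> verts Q" by (auto simp: r quiver_paths_iff)
    have "(\<one>\<^bsub>A\<^esub> \<otimes>\<^bsub>A\<^esub> f) r = (\<Sum>(p, q)\<in>{((u, [], u), r)}. \<one>\<^bsub>A\<^esub> p * f q)"
      unfolding path_algebra_simps(2)
      by (rule sum.mono_neutral_right)
         (use u in \<open>auto simp: path_algebra_simps(3) path_factorizations_iff r quiver_paths_iff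
            awalk_Nil_iff split: if_splits\<close>)
    also have "\<dots> = f r" using u by (simp add: path_algebra_simps)
    finally show ?thesis .
  qed
qed

lemma path_algebra_r_one:
  assumes f: "f \<in> carrier A" shows "f \<otimes>\<^bsub>A\<^esub> \<one>\<^bsub>A\<^esub> = f"
proof
  fix r :: "('q, 'a) path"
  obtain u as v where r: "r = (u, as, v)" by (cases r) auto
  show "(f \<otimes>\<^bsub>A\<^esub> \<one>\<^bsub>A\<^esub>) r = f r"
  proof (cases "r \<in> quiver_paths Q")
    case False
    then have "path_factorizations Q r = {}"
      by (auto simp: path_factorizations_iff quiver_paths_append)
    with False f show ?thesis by (simp add: path_algebra_simps(2) path_algebra_eval_outside)
  next
    case True
    then have u: "awalk u as v" "v \<in> verts Q" by (auto simp: r quiver_paths_iff)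
    have "(f \<otimes>\<^bsub>A\<^esub> \<one>\<^bsub>A\<^esub>) r = (\<Sum>(p, q)\<in>{(r, (v, [], v))}. f p * \<one>\<^bsub>A\<^esub> q)"
      unfolding path_algebra_simps(2)
      by (rule sum.mono_neutral_right)
         (use u in \<open>auto simp: path_algebra_simps(3) path_factorizations_iff r quiver_paths_iff
            awalk_Nil_iff split: if_splits\<close>)
    also have "\<dots> = f r" using u by (simp add: path_algebra_simps)
    finally show ?thesis .
  qed
qed

lemma path_algebra_abelian_group: "abelian_group (A :: ('k::field, _) module)"
proof (rule abelian_groupI)
  fix f :: "('q, 'a) path \<Rightarrow> 'k" assume f: "f \<in> carrier A"
  show "\<exists>g\<in>carrier A. g \<oplus>\<^bsub>A\<^esub> f = \<zero>\<^bsub>A\<^esub>"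
    by (rule bexI[OF _ path_algebra_smult_closed[OF f, of "-1"]]) (simp add: path_algebra_simps)
qed (auto simp: path_algebra_add_closed, auto simp: path_algebra_simps add_ac)

lemma path_algebra_ring: "ring (A :: ('k::field, _) module)"
proof (rule ringI[OF path_algebra_abelian_group])
  show "monoid (A :: ('k::field, _) module)"
    by (rule monoidI)
       (simp_all add: path_algebra_mult_closed path_algebra_one_closed path_algebra_mult_assoc
          path_algebra_l_one path_algebra_r_one)
qed (auto simp: path_algebra_simps case_prod_unfold sum.distrib algebra_simps fun_eq_iff)

lemma path_algebra_module: "module class_ring (A :: ('k::field, _) module)"
  by (rule moduleI[OF class_cring path_algebra_abelian_group])
     (auto simp: path_algebra_smult_closed, auto simp: path_algebra_simps algebra_simps)

lemma path_algebra_smult_mult: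
  "(c \<odot>\<^bsub>A\<^esub> f) \<otimes>\<^bsub>A\<^esub> g = c \<odot>\<^bsub>A\<^esub> (f \<otimes>\<^bsub>A\<^esub> g)"
  "f \<otimes>\<^bsub>A\<^esub> (c \<odot>\<^bsub>A\<^esub> g) = c \<odot>\<^bsub>A\<^esub> (f \<otimes>\<^bsub>A\<^esub> g)"
  by (auto simp: path_algebra_simps case_prod_unfold sum_distrib_left mult_ac)

lemma path_algebra_minus:
  assumes "f \<in> carrier A" "g \<in> carrier A"
  shows "f \<ominus>\<^bsub>A\<^esub> g = (\<lambda>p. f p - g p)"
proof -
  interpret ring A by (rule path_algebra_ring)
  have "\<ominus>\<^bsub>A\<^esub> g = (-1) \<odot>\<^bsub>A\<^esub> g"
    by (rule minus_equality)
       (use assms in \<open>simp_all add: path_algebra_smult_closed\<close>, simp add: path_algebra_simps)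
  then show ?thesis by (simp add: a_minus_def path_algebra_simps)
qed

lemma path_elem_closed: "p \<in> quiver_paths Q \<Longrightarrow> path_elem p \<in> carrier A"
  by (auto simp: path_algebra_simps path_elem_def)

lemma path_elem_mult:
  assumes "p \<in> quiver_paths Q" "q \<in> quiver_paths Q" "snd (snd p) = fst q"
  shows "path_elem p \<otimes>\<^bsub>A\<^esub> path_elem q = path_elem (path_concat p q)"
proof
  fix r
  have "(path_elem p \<otimes>\<^bsub>A\<^esub> path_elem q) r =
      (\<Sum>x\<in>path_factorizations Q r. if x = (p, q) then 1 else 0)"
    unfolding path_algebra_simps(2) case_prod_unfold
    by (rule sum.cong) (simp_all add: path_elem_def prod_eq_iff)
  also have "\<dots> = (if (p, q) \<in> path_factorizations Q r then 1 else 0)"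
    by (simp add: sum.delta)
  also have "\<dots> = path_elem (path_concat p q) r"
    using assms by (simp only: path_factorizations_iff path_elem_def simp_thms)
  finally show "(path_elem p \<otimes>\<^bsub>A\<^esub> path_elem q) r = path_elem (path_concat p q) r" .
qed

lemma ideal_smult_closed:
  assumes I: "ideal I (A :: ('k::field, _) module)" and f: "f \<in> I"
  shows "(\<lambda>p. c * f p) \<in> I"
proof -
  interpret I: ideal I A by (rule I)
  have fc: "f \<in> carrier A" using f by (rule I.Icarr)
  have "(c \<odot>\<^bsub>A\<^esub> \<one>\<^bsub>A\<^esub>) \<otimes>\<^bsub>A\<^esub> f \<in> I"
    by (intro I.I_l_closed f path_algebra_smult_closed path_algebra_one_closed)
  then show ?thesis
    unfolding path_algebra_smult_mult path_algebra_l_one[OF fc] by (simp add: path_algebra_simps)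
qed

lemma ideal_sum_closed:
  assumes I: "ideal I (A :: ('k::field, _) module)" and "finite T" "\<And>t. t \<in> T \<Longrightarrow> h t \<in> I"
  shows "(\<lambda>p. \<Sum>t\<in>T. h t p) \<in> I"
proof -
  interpret I: ideal I A by (rule I)
  show ?thesis using assms(2,3)
  proof (induction T rule: finite_induct)
    case empty
    then show ?case using additive_subgroup.zero_closed[OF ideal.axioms(1)[OF I]]
      unfolding path_algebra_simps(4) by simp
  next
    case (insert t T)
    then have "h t \<oplus>\<^bsub>A\<^esub> (\<lambda>p. \<Sum>t\<in>T. h t p) \<in> I" 
      by (intro additive_subgroup.a_closed[OF ideal.axioms(1)[OF I]]) auto
    with insert.hyps show ?case by (simp add: path_algebra_simps)
  qed
qed

lemma ideal_path_elem_concat: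
  assumes I: "ideal I (A :: ('k::field, _) module)" and q: "path_elem q \<in> I"
    and paths: "p \<in> quiver_paths Q" "q \<in> quiver_paths Q" "r \<in> quiver_paths Q"
    and composable: "snd (snd p) = fst q" "snd (snd q) = fst r"
  shows "path_elem (path_concat p (path_concat q r)) \<in> I"
proof -
  interpret I: ideal I A by (rule I)
  have "path_elem p \<otimes>\<^bsub>A\<^esub> (path_elem q \<otimes>\<^bsub>A\<^esub> path_elem r) \<in> I"
    by (intro I.I_l_closed I.I_r_closed q path_elem_closed paths)
  then show ?thesis
    using paths composable by (simp add: path_elem_mult quiver_paths_concat)
qed

end

section \<open>Dimensions of centers of quotient algebras\<close>

text \<open>
  A family of vectors with a dual family of functionals is linearly independent, and it spans as
  soon as the functionals separate points: any \<open>x\<close> differs from the combination of the vectors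
  with coefficients \<open>c j x\<close> by an element on which all functionals vanish.
\<close>

lemma dim_eq_card_of_dual_family:
  fixes V :: "('k::field, 'b) module" and b :: "'j \<Rightarrow> 'b" and c :: "'j \<Rightarrow> 'b \<Rightarrow> 'k"
  assumes vs: "vectorspace class_ring V" and fin: "finite J"
    and b: "\<And>j. j \<in> J \<Longrightarrow> b j \<in> carrier V"
    and add: "\<And>j x y. j \<in> J \<Longrightarrow> x \<in> carrier V \<Longrightarrow> y \<in> carrier V \<Longrightarrow> c j (x \<oplus>\<^bsub>V\<^esub> y) = c j x + c j y"
    and smult: "\<And>j a x. j \<in> J \<Longrightarrow> x \<in> carrier V \<Longrightarrow> c j (a \<odot>\<^bsub>V\<^esub> x) = a * c j x"
    and dual: "\<And>i j. i \<in> J \<Longrightarrow> j \<in> J \<Longrightarrow> c j (b i) = (if i = j then 1 else 0)"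
    and separating: "\<And>x. x \<in> carrier V \<Longrightarrow> (\<And>j. j \<in> J \<Longrightarrow> c j x = 0) \<Longrightarrow> x = \<zero>\<^bsub>V\<^esub>"
  shows "vectorspace.fin_dim class_ring V \<and> vectorspace.dim class_ring V = card J"
proof -
  interpret V: vectorspace "class_ring :: 'k ring" V by (rule vs)
  let ?B = "b ` J"
  have B: "finite ?B" "?B \<subseteq> carrier V" using fin b by auto
  have inj: "inj_on b J"
  proof (rule inj_onI)
    fix i j assume "i \<in> J" "j \<in> J" "b i = b j"
    then have "(if i = j then 1 else 0 :: 'k) = 1" using dual[of i j] dual[of j j] by simp
    then show "i = j" by (simp split: if_splits)
  qed
  have c_zero: "c j \<zero>\<^bsub>V\<^esub> = 0" if j: "j \<in> J" for j
  proof -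
    have "0 \<odot>\<^bsub>V\<^esub> \<zero>\<^bsub>V\<^esub> = \<zero>\<^bsub>V\<^esub>" by (rule V.smult_r_null) simp
    then show ?thesis using smult[OF j V.zero_closed, of 0] by simp
  qed
  have c_finsum: "c j (finsum V f S) = (\<Sum>v\<in>S. c j (f v))"
    if "finite S" "f \<in> S \<rightarrow> carrier V" and j: "j \<in> J" for j f and S :: "'b set"
    using that(1,2)
  proof (induction S rule: finite_induct)
    case empty
    show ?case by (simp only: V.finsum_empty c_zero[OF j] sum.empty)
  next
    case (insert v S)
    have f: "f \<in> S \<rightarrow> carrier V" "f v \<in> carrier V" using insert.prems by auto
    have "c j (finsum V f (insert v S)) = c j (f v) + c j (finsum V f S)"
      using add[OF j f(2) V.finsum_closed[OF f(1)]]
      by (simp only: V.finsum_insert[OF insert.hyps f])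
    then show ?case by (simp only: insert.IH[OF f(1)] sum.insert[OF insert.hyps])
  qed
  have c_lincomb: "c j (V.lincomb a ?B) = a (b j)" if j: "j \<in> J" for a j
  proof -
    have cl: "(\<lambda>v. a v \<odot>\<^bsub>V\<^esub> v) \<in> ?B \<rightarrow> carrier V" using b by (intro Pi_I V.smult_closed) auto
    have "c j (V.lincomb a ?B) = (\<Sum>v\<in>?B. c j (a v \<odot>\<^bsub>V\<^esub> v))"
      unfolding V.lincomb_def by (rule c_finsum[OF B(1) cl j])
    also have "\<dots> = (\<Sum>i\<in>J. c j (a (b i) \<odot>\<^bsub>V\<^esub> b i))"
      by (simp add: sum.reindex[OF inj])
    also have "\<dots> = (\<Sum>i\<in>J. if i = j then a (b i) else 0)"
      by (rule sum.cong) (simp_all add: smult b dual j)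
    also have "\<dots> = a (b j)" using fin j by simp
    finally show ?thesis .
  qed
  have indep: "V.lin_indpt ?B"
  proof (rule V.finite_lin_indpt2[OF B])
    fix a assume "V.lincomb a ?B = \<zero>\<^bsub>V\<^esub>"
    then show "\<forall>v\<in>?B. a v = \<zero>\<^bsub>class_ring\<^esub>"
      using c_lincomb[of _ a] c_zero by auto
  qed
  have "x \<in> V.span ?B" if x: "x \<in> carrier V" for x
  proof -
    define a where "a v = c (the_inv_into J b v) x" for v
    define y where "y = V.lincomb a ?B"
    have y: "y \<in> carrier V" unfolding y_def using B by (auto intro!: V.lincomb_closed)
    have a: "a (b j) = c j x" if "j \<in> J" for j
      by (simp add: a_def the_inv_into_f_f[OF inj that])
    define w where "w = (-1) \<odot>\<^bsub>V\<^esub> y"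
    have w: "w \<in> carrier V" unfolding w_def by (rule V.smult_closed[OF _ y]) simp
    have "c j (x \<oplus>\<^bsub>V\<^esub> w) = 0" if "j \<in> J" for j
      using that by (simp add: add x w) (simp add: w_def smult y, simp add: y_def c_lincomb a)
    then have xw: "x \<oplus>\<^bsub>V\<^esub> w = \<zero>\<^bsub>V\<^esub>"
      by (intro separating V.add.m_closed x w)
    have wy: "w \<oplus>\<^bsub>V\<^esub> y = \<zero>\<^bsub>V\<^esub>"
      using V.smult_l_distr[of "-1" 1 y] V.smult_l_null[OF y] V.smult_one[OF y] y
      by (simp add: w_def)
    have "x = x \<oplus>\<^bsub>V\<^esub> (w \<oplus>\<^bsub>V\<^esub> y)" by (simp only: wy V.r_zero[OF x])
    also have "\<dots> = y" by (simp only: V.a_assoc[OF x w y, symmetric] xw V.l_zero[OF y])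
    finally have "x = y" .
    then show ?thesis
      unfolding y_def using B V.span_def by auto
  qed
  then have gen: "V.gen_set ?B"
    using V.span_is_subset2[OF B(2)] by auto
  have "V.basis ?B" unfolding V.basis_def using indep gen B by auto
  then have "V.dim = card J"
    using V.dim_basis[OF B(1)] card_image[OF inj] by simp
  moreover have "V.fin_dim" unfolding V.fin_dim_def using B gen by blast
  ultimately show ?thesis by blast
qed

locale quotient_algebra = A: ring A + I: ideal I A
  for A :: "('k::field, 'b) module" and I +
  assumes A_module: "module class_ring A"
    and smult_mult_left: "x \<in> carrier A \<Longrightarrow> y \<in> carrier A \<Longrightarrow>
      (a \<odot>\<^bsub>A\<^esub> x) \<otimes>\<^bsub>A\<^esub> y = a \<odot>\<^bsub>A\<^esub> (x \<otimes>\<^bsub>A\<^esub> y)"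
    and smult_mult_right: "x \<in> carrier A \<Longrightarrow> y \<in> carrier A \<Longrightarrow>
      x \<otimes>\<^bsub>A\<^esub> (a \<odot>\<^bsub>A\<^esub> y) = a \<odot>\<^bsub>A\<^esub> (x \<otimes>\<^bsub>A\<^esub> y)"
begin

abbreviation "\<Lambda> \<equiv> quot_algebra A I"

abbreviation coset where "coset x \<equiv> I +>\<^bsub>A\<^esub> x"

lemma smult_closed: "x \<in> carrier A \<Longrightarrow> a \<odot>\<^bsub>A\<^esub> x \<in> carrier A"
  using module.smult_closed[OF A_module] by simp

lemma smult_mem_ideal:
  assumes x: "x \<in> I" shows "a \<odot>\<^bsub>A\<^esub> x \<in> I"
proof -
  have xc: "x \<in> carrier A" using x by (rule I.Icarr)
  have "a \<odot>\<^bsub>A\<^esub> x = (a \<odot>\<^bsub>A\<^esub> \<one>\<^bsub>A\<^esub>) \<otimes>\<^bsub>A\<^esub> x" using xc by (simp add: smult_mult_left)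
  then show ?thesis using I.I_l_closed[OF x smult_closed[OF A.one_closed]] by simp
qed

lemma coset_eq_iff:
  "x \<in> carrier A \<Longrightarrow> y \<in> carrier A \<Longrightarrow> coset x = coset y \<longleftrightarrow> x \<ominus>\<^bsub>A\<^esub> y \<in> I"
  using A.quotient_eq_iff_same_a_r_cos[OF I.is_ideal] by simp

lemma carrier_quot: "carrier \<Lambda> = coset ` carrier A"
  by (auto simp: quot_algebra_def FactRing_def A_RCOSETS_def' )

lemma quot_ops:
  "x \<in> carrier A \<Longrightarrow> y \<in> carrier A \<Longrightarrow> coset x \<otimes>\<^bsub>\<Lambda>\<^esub> coset y = coset (x \<otimes>\<^bsub>A\<^esub> y)"
  "x \<in> carrier A \<Longrightarrow> y \<in> carrier A \<Longrightarrow> coset x \<oplus>\<^bsub>\<Lambda>\<^esub> coset y = coset (x \<oplus>\<^bsub>A\<^esub> y)"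
  "\<one>\<^bsub>\<Lambda>\<^esub> = coset \<one>\<^bsub>A\<^esub>"
  "\<zero>\<^bsub>\<Lambda>\<^esub> = coset \<zero>\<^bsub>A\<^esub>"
proof -
  show "\<zero>\<^bsub>\<Lambda>\<^esub> = coset \<zero>\<^bsub>A\<^esub>"
    unfolding A.a_coset_add_zero[OF I.a_subset] by (simp add: quot_algebra_def FactRing_def)
qed (simp_all add: quot_algebra_def FactRing_def I.rcoset_mult_add I.a_rcos_sum)

lemma coset_eq_zero_iff: "x \<in> carrier A \<Longrightarrow> coset x = \<zero>\<^bsub>\<Lambda>\<^esub> \<longleftrightarrow> x \<in> I"
  unfolding quot_ops using coset_eq_iff[of x "\<zero>\<^bsub>A\<^esub>"] by (simp add: a_minus_def)

text \<open>
  The union in the definition of the scalar multiple of a coset is taken over its representatives;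
  these differ by elements of the ideal, which is closed under scalars, so the sets coincide.
\<close>

lemma quot_smult:
  assumes x: "x \<in> carrier A" shows "a \<odot>\<^bsub>\<Lambda>\<^esub> coset x = coset (a \<odot>\<^bsub>A\<^esub> x)"
proof -
  interpret M: module class_ring A by (rule A_module)
  have "coset (a \<odot>\<^bsub>A\<^esub> y) = coset (a \<odot>\<^bsub>A\<^esub> x)" if y: "y \<in> coset x" for y
  proof -
    obtain i where i: "i \<in> I" "y = i \<oplus>\<^bsub>A\<^esub> x"
      using y unfolding a_r_coset_def' by auto
    have ic: "i \<in> carrier A" using i(1) by (rule I.Icarr)
    have "a \<odot>\<^bsub>A\<^esub> y \<ominus>\<^bsub>A\<^esub> a \<odot>\<^bsub>A\<^esub> x = a \<odot>\<^bsub>A\<^esub> i"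
      using ic x by (simp add: i(2) M.smult_r_distr smult_closed a_minus_def A.a_assoc A.r_neg)
    then show ?thesis
      using smult_mem_ideal[OF i(1)] ic x by (simp add: coset_eq_iff smult_closed i(2))
  qed
  moreover have "x \<in> coset x" using I.a_rcos_self[OF x] .
  ultimately have "(\<Union>y\<in>coset x. coset (a \<odot>\<^bsub>A\<^esub> y)) = coset (a \<odot>\<^bsub>A\<^esub> x)"
    by (intro SUP_eq_const) blast
  then show ?thesis by (simp only: quot_algebra_def module.simps)
qed

lemma quot_closed:
  "X \<in> carrier \<Lambda> \<Longrightarrow> Y \<in> carrier \<Lambda> \<Longrightarrow> X \<otimes>\<^bsub>\<Lambda>\<^esub> Y \<in> carrier \<Lambda>"
  "X \<in> carrier \<Lambda> \<Longrightarrow> Y \<in> carrier \<Lambda> \<Longrightarrow> X \<oplus>\<^bsub>\<Lambda>\<^esub> Y \<in> carrier \<Lambda>"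
  "\<one>\<^bsub>\<Lambda>\<^esub> \<in> carrier \<Lambda>" "\<zero>\<^bsub>\<Lambda>\<^esub> \<in> carrier \<Lambda>"
  "X \<in> carrier \<Lambda> \<Longrightarrow> a \<odot>\<^bsub>\<Lambda>\<^esub> X \<in> carrier \<Lambda>"
  unfolding carrier_quot
  by ((elim imageE)?, simp only: quot_ops quot_smult, rule imageI, simp add: smult_closed)+

lemma quot_ring: "ring \<Lambda>"
proof (rule ringI)
  show "abelian_group \<Lambda>"
  proof (rule abelian_groupI)
    fix X assume "X \<in> carrier \<Lambda>"
    then obtain x where x: "x \<in> carrier A" "X = coset x" by (auto simp: carrier_quot)
    show "\<exists>Y\<in>carrier \<Lambda>. Y \<oplus>\<^bsub>\<Lambda>\<^esub> X = \<zero>\<^bsub>\<Lambda>\<^esub>"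
    proof
      show "coset (\<ominus>\<^bsub>A\<^esub> x) \<in> carrier \<Lambda>" unfolding carrier_quot using x by (intro imageI) simp
      show "coset (\<ominus>\<^bsub>A\<^esub> x) \<oplus>\<^bsub>\<Lambda>\<^esub> X = \<zero>\<^bsub>\<Lambda>\<^esub>" using x by (simp only: quot_ops A.a_inv_closed A.l_neg)
    qed
    show "\<zero>\<^bsub>\<Lambda>\<^esub> \<oplus>\<^bsub>\<Lambda>\<^esub> X = X" using x by (simp only: quot_ops A.zero_closed A.l_zero)
  next
    fix X Y assume "X \<in> carrier \<Lambda>" "Y \<in> carrier \<Lambda>"
    then show "X \<oplus>\<^bsub>\<Lambda>\<^esub> Y = Y \<oplus>\<^bsub>\<Lambda>\<^esub> X"
      unfolding carrier_quot by (elim imageE) (simp only: quot_ops A.a_comm)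
  next
    fix X Y Z assume "X \<in> carrier \<Lambda>" "Y \<in> carrier \<Lambda>" "Z \<in> carrier \<Lambda>"
    then show "X \<oplus>\<^bsub>\<Lambda>\<^esub> Y \<oplus>\<^bsub>\<Lambda>\<^esub> Z = X \<oplus>\<^bsub>\<Lambda>\<^esub> (Y \<oplus>\<^bsub>\<Lambda>\<^esub> Z)"
      unfolding carrier_quot by (elim imageE) (simp only: quot_ops A.add.m_closed A.a_assoc)
  qed (rule quot_closed; assumption)+
  show "monoid \<Lambda>"
  proof (rule monoidI)
    fix X Y Z assume "X \<in> carrier \<Lambda>" "Y \<in> carrier \<Lambda>" "Z \<in> carrier \<Lambda>"
    then show "X \<otimes>\<^bsub>\<Lambda>\<^esub> Y \<otimes>\<^bsub>\<Lambda>\<^esub> Z = X \<otimes>\<^bsub>\<Lambda>\<^esub> (Y \<otimes>\<^bsub>\<Lambda>\<^esub> Z)"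
      unfolding carrier_quot by (elim imageE) (simp only: quot_ops A.m_closed A.m_assoc)
  next
    fix X assume "X \<in> carrier \<Lambda>"
    then show "\<one>\<^bsub>\<Lambda>\<^esub> \<otimes>\<^bsub>\<Lambda>\<^esub> X = X" "X \<otimes>\<^bsub>\<Lambda>\<^esub> \<one>\<^bsub>\<Lambda>\<^esub> = X"
      unfolding carrier_quot by (elim imageE; simp only: quot_ops A.one_closed A.l_one A.r_one)+
  qed (rule quot_closed; assumption)+
next
  fix X Y Z assume "X \<in> carrier \<Lambda>" "Y \<in> carrier \<Lambda>" "Z \<in> carrier \<Lambda>"
  then show "(X \<oplus>\<^bsub>\<Lambda>\<^esub> Y) \<otimes>\<^bsub>\<Lambda>\<^esub> Z = X \<otimes>\<^bsub>\<Lambda>\<^esub> Z \<oplus>\<^bsub>\<Lambda>\<^esub> Y \<otimes>\<^bsub>\<Lambda>\<^esub> Z"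
    "Z \<otimes>\<^bsub>\<Lambda>\<^esub> (X \<oplus>\<^bsub>\<Lambda>\<^esub> Y) = Z \<otimes>\<^bsub>\<Lambda>\<^esub> X \<oplus>\<^bsub>\<Lambda>\<^esub> Z \<otimes>\<^bsub>\<Lambda>\<^esub> Y"
    unfolding carrier_quot
    by (elim imageE; simp only: quot_ops A.m_closed A.add.m_closed A.l_distr A.r_distr)+
qed

lemma quot_module: "module class_ring \<Lambda>"
proof -
  interpret M: module class_ring A by (rule A_module)
  interpret Q: ring \<Lambda> by (rule quot_ring)
  have M: "(a + b) \<odot>\<^bsub>A\<^esub> x = a \<odot>\<^bsub>A\<^esub> x \<oplus>\<^bsub>A\<^esub> b \<odot>\<^bsub>A\<^esub> x"
    "a \<odot>\<^bsub>A\<^esub> (x \<oplus>\<^bsub>A\<^esub> y) = a \<odot>\<^bsub>A\<^esub> x \<oplus>\<^bsub>A\<^esub> a \<odot>\<^bsub>A\<^esub> y"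
    "(a * b) \<odot>\<^bsub>A\<^esub> x = a \<odot>\<^bsub>A\<^esub> (b \<odot>\<^bsub>A\<^esub> x)" "1 \<odot>\<^bsub>A\<^esub> x = x"
    if "x \<in> carrier A" "y \<in> carrier A" for a b x y
    using that M.smult_l_distr[of a b x] M.smult_r_distr[of a x y] M.smult_assoc1[of a b x]
      M.smult_one[of x] by simp_all
  show ?thesis
  proof (rule moduleI[OF class_cring Q.abelian_group_axioms])
    fix a X assume "X \<in> carrier \<Lambda>"
    then show "a \<odot>\<^bsub>\<Lambda>\<^esub> X \<in> carrier \<Lambda>" by (rule quot_closed)
  next
    fix a b X assume "X \<in> carrier \<Lambda>"
    then obtain x where x: "x \<in> carrier A" "X = coset x" by (auto simp: carrier_quot)
    then show "(a \<oplus>\<^bsub>class_ring\<^esub> b) \<odot>\<^bsub>\<Lambda>\<^esub> X = a \<odot>\<^bsub>\<Lambda>\<^esub> X \<oplus>\<^bsub>\<Lambda>\<^esub> b \<odot>\<^bsub>\<Lambda>\<^esub> X"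
      "(a \<otimes>\<^bsub>class_ring\<^esub> b) \<odot>\<^bsub>\<Lambda>\<^esub> X = a \<odot>\<^bsub>\<Lambda>\<^esub> (b \<odot>\<^bsub>\<Lambda>\<^esub> X)"
      "\<one>\<^bsub>class_ring\<^esub> \<odot>\<^bsub>\<Lambda>\<^esub> X = X"
      by (simp_all add: quot_smult quot_ops smult_closed M)
  next
    fix a X Y assume "X \<in> carrier \<Lambda>" "Y \<in> carrier \<Lambda>"
    then show "a \<odot>\<^bsub>\<Lambda>\<^esub> (X \<oplus>\<^bsub>\<Lambda>\<^esub> Y) = a \<odot>\<^bsub>\<Lambda>\<^esub> X \<oplus>\<^bsub>\<Lambda>\<^esub> a \<odot>\<^bsub>\<Lambda>\<^esub> Y"
      unfolding carrier_quot
      by (elim imageE) (simp only: quot_ops quot_smult smult_closed A.add.m_closed M)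
  qed
qed

lemma coset_central_iff:
  assumes z: "z \<in> carrier A"
  shows "coset z \<in> ring_center \<Lambda> \<longleftrightarrow>
    (\<forall>x\<in>carrier A. z \<otimes>\<^bsub>A\<^esub> x \<ominus>\<^bsub>A\<^esub> x \<otimes>\<^bsub>A\<^esub> z \<in> I)"
  using z by (auto simp: ring_center_def carrier_quot quot_ops coset_eq_iff)

lemma center_vectorspace: "vectorspace class_ring (center_space \<Lambda>)"
proof -
  interpret Q: ring \<Lambda> by (rule quot_ring)
  interpret M: module class_ring \<Lambda> by (rule quot_module)
  have sm: "(a \<odot>\<^bsub>\<Lambda>\<^esub> X) \<otimes>\<^bsub>\<Lambda>\<^esub> Y = a \<odot>\<^bsub>\<Lambda>\<^esub> (X \<otimes>\<^bsub>\<Lambda>\<^esub> Y)"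
    "X \<otimes>\<^bsub>\<Lambda>\<^esub> (a \<odot>\<^bsub>\<Lambda>\<^esub> Y) = a \<odot>\<^bsub>\<Lambda>\<^esub> (X \<otimes>\<^bsub>\<Lambda>\<^esub> Y)"
    if "X \<in> carrier \<Lambda>" "Y \<in> carrier \<Lambda>" for a X Y
    using that by (auto simp: carrier_quot quot_ops quot_smult smult_closed smult_mult_left smult_mult_right)
  have "submodule class_ring (ring_center \<Lambda>) \<Lambda>"
    by (rule submodule.intro[OF quot_module])
       (auto simp: ring_center_def Q.l_distr Q.r_distr sm intro: M.smult_closed)
  then have "module class_ring (center_space \<Lambda>)"
    unfolding center_space_def by (rule M.submodule_is_module)
  then show ?thesis by (rule vectorspace.intro[OF _ class_field])
qed

text \<open>
  A functional on the quotient is a functional on the algebra that vanishes on the ideal, and an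
  element is central modulo the ideal if all its commutators lie in the ideal. With this
  dictionary the dimension of the center can be read off from data in the algebra itself.
\<close>

lemma dim_center_eq_card_of_dual_family:
  fixes b :: "'j \<Rightarrow> 'b" and c :: "'j \<Rightarrow> 'b \<Rightarrow> 'k"
  assumes fin: "finite J"
    and b: "\<And>j. j \<in> J \<Longrightarrow> b j \<in> carrier A"
    and central: "\<And>j x. j \<in> J \<Longrightarrow> x \<in> carrier A \<Longrightarrow> b j \<otimes>\<^bsub>A\<^esub> x \<ominus>\<^bsub>A\<^esub> x \<otimes>\<^bsub>A\<^esub> b j \<in> I"
    and add: "\<And>j x y. j \<in> J \<Longrightarrow> x \<in> carrier A \<Longrightarrow> y \<in> carrier A \<Longrightarrow> c j (x \<oplus>\<^bsub>A\<^esub> y) = c j x + c j y"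
    and smult: "\<And>j a x. j \<in> J \<Longrightarrow> x \<in> carrier A \<Longrightarrow> c j (a \<odot>\<^bsub>A\<^esub> x) = a * c j x"
    and vanishing: "\<And>j x. j \<in> J \<Longrightarrow> x \<in> I \<Longrightarrow> c j x = 0"
    and dual: "\<And>i j. i \<in> J \<Longrightarrow> j \<in> J \<Longrightarrow> c j (b i) = (if i = j then 1 else 0)"
    and separating: "\<And>z. z \<in> carrier A \<Longrightarrow>
      (\<And>x. x \<in> carrier A \<Longrightarrow> z \<otimes>\<^bsub>A\<^esub> x \<ominus>\<^bsub>A\<^esub> x \<otimes>\<^bsub>A\<^esub> z \<in> I) \<Longrightarrow>
      (\<And>j. j \<in> J \<Longrightarrow> c j z = 0) \<Longrightarrow> z \<in> I"
  shows "vectorspace.fin_dim class_ring (center_space \<Lambda>) \<and>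
    vectorspace.dim class_ring (center_space \<Lambda>) = card J"
proof -
  \<comment> \<open>The choice of representative is immaterial because \<open>c j\<close> vanishes on the ideal.\<close>
  define c' where "c' j X = c j (SOME x. x \<in> X)" for j X
  have c': "c' j (coset x) = c j x" if j: "j \<in> J" and x: "x \<in> carrier A" for j x
  proof -
    have "(SOME y. y \<in> coset x) \<in> coset x"
      using I.a_rcos_self[OF x] by (rule someI)
    then obtain i where i: "i \<in> I" "(SOME y. y \<in> coset x) = i \<oplus>\<^bsub>A\<^esub> x"
      unfolding a_r_coset_def' by auto
    then show ?thesis
      using add[OF j I.Icarr[OF i(1)] x] vanishing[OF j i(1)] by (simp add: c'_def)
  qed
  have car: "X \<in> carrier (center_space \<Lambda>) \<longleftrightarrow> X \<in> ring_center \<Lambda>" for X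
    by (simp add: center_space_def)
  have rep: "\<exists>x\<in>carrier A. X = coset x" if "X \<in> ring_center \<Lambda>" for X
    using that by (auto simp: ring_center_def carrier_quot)
  have ops: "X \<oplus>\<^bsub>center_space \<Lambda>\<^esub> Y = X \<oplus>\<^bsub>\<Lambda>\<^esub> Y"
    "a \<odot>\<^bsub>center_space \<Lambda>\<^esub> X = a \<odot>\<^bsub>\<Lambda>\<^esub> X" "\<zero>\<^bsub>center_space \<Lambda>\<^esub> = \<zero>\<^bsub>\<Lambda>\<^esub>" for X Y a
    by (simp_all add: center_space_def)
  show ?thesis
  proof (rule dim_eq_card_of_dual_family[OF center_vectorspace fin,
        where b = "\<lambda>j. coset (b j)" and c = c'])
    show "coset (b j) \<in> carrier (center_space \<Lambda>)" if "j \<in> J" for j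
      using that central b by (simp add: car coset_central_iff)
    show "c' j (X \<oplus>\<^bsub>center_space \<Lambda>\<^esub> Y) = c' j X + c' j Y"
      if "j \<in> J" "X \<in> carrier (center_space \<Lambda>)" "Y \<in> carrier (center_space \<Lambda>)" for j X Y
      using that rep[of X] rep[of Y] by (auto simp: car ops quot_ops c' add)
    show "c' j (a \<odot>\<^bsub>center_space \<Lambda>\<^esub> X) = a * c' j X"
      if "j \<in> J" "X \<in> carrier (center_space \<Lambda>)" for j a X
      using that rep[of X] by (auto simp: car ops quot_smult c' smult smult_closed)
    show "c' j (coset (b i)) = (if i = j then 1 else 0)" if "i \<in> J" "j \<in> J" for i j
      using that by (simp add: c' b dual)
    show "X = \<zero>\<^bsub>center_space \<Lambda>\<^esub>"
      if "X \<in> carrier (center_space \<Lambda>)" and zero: "\<And>j. j \<in> J \<Longrightarrow> c' j X = 0" for X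
    proof -
      obtain z where z: "z \<in> carrier A" "X = coset z" using rep \<open>X \<in> _\<close> car by blast
      have "coset z \<in> ring_center \<Lambda>" using \<open>X \<in> _\<close> z by (simp only: car)
      then have comm: "\<forall>x\<in>carrier A. z \<otimes>\<^bsub>A\<^esub> x \<ominus>\<^bsub>A\<^esub> x \<otimes>\<^bsub>A\<^esub> z \<in> I"
        using coset_central_iff[OF z(1)] by blast
      have "c j z = 0" if "j \<in> J" for j
        using zero[OF that] c'[OF that z(1)] z(2) by simp
      with comm have "z \<in> I" using separating[OF z(1)] by blast
      then show ?thesis using z by (simp add: ops coset_eq_zero_iff)
    qed
  qed
qed

end

section \<open>Paths along successor sequences\<close>

context brauer_configuration
begin

abbreviation "Q \<equiv> bc_quiver \<Gamma>"

abbreviation "nontruncated \<equiv> bc_verts \<Gamma> - truncated \<Gamma>"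

text \<open>
  The number of arrows in the \<open>\<mu>(\<alpha>)\<close>-th power of a special \<open>\<alpha>\<close>-cycle, the maximal length of a
  path along the successor sequence of \<open>\<alpha>\<close> that survives in the algebra.
\<close>

definition full_length :: "'v \<Rightarrow> nat" where
  "full_length \<alpha> = val \<Gamma> \<alpha> * bc_mu \<Gamma> \<alpha>"

lemma val_pos:
  assumes "\<alpha> \<in> bc_verts \<Gamma>" shows "val \<Gamma> \<alpha> > 0"
proof -
  obtain V where "V \<in> bc_polys \<Gamma>" "\<alpha> \<in># bc_mset \<Gamma> V" using C1[OF assms] by blast
  then have "occ \<Gamma> \<alpha> V > 0" "occ \<Gamma> \<alpha> V \<le> val \<Gamma> \<alpha>"
    using member_le_sum[of V "bc_polys \<Gamma>" "occ \<Gamma> \<alpha>"] finite_polys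
    by (auto simp: occ_def val_def)
  then show ?thesis by simp
qed

lemma nontruncated_cases:
  assumes "\<alpha> \<in> nontruncated" shows "val \<Gamma> \<alpha> > 1 \<or> bc_mu \<Gamma> \<alpha> > 1"
proof (rule ccontr)
  assume "\<not> ?thesis"
  then have "val \<Gamma> \<alpha> = 1" "bc_mu \<Gamma> \<alpha> = 1"
    using val_pos[of \<alpha>] mu_pos[of \<alpha>] assms by auto
  with assms show False by (auto simp: truncated_def)
qed

lemma full_length_gt_1:
  assumes "\<alpha> \<in> nontruncated" shows "full_length \<alpha> > 1"
proof -
  have "val \<Gamma> \<alpha> * bc_mu \<Gamma> \<alpha> \<noteq> 1"
    using assms by (auto simp: truncated_def mult.commute)
  moreover have "val \<Gamma> \<alpha> * bc_mu \<Gamma> \<alpha> \<noteq> 0"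
    using val_pos[of \<alpha>] mu_pos[of \<alpha>] assms by auto
  ultimately show ?thesis unfolding full_length_def by linarith
qed

lemma count_succ:
  "\<alpha> \<in> nontruncated \<Longrightarrow>
    count (mset (bc_succ \<Gamma> \<alpha>)) V = (if V \<in> bc_polys \<Gamma> then occ \<Gamma> \<alpha> V else 0)"
  using orientation nontruncated_cases by blast

lemma set_succ:
  assumes "\<alpha> \<in> nontruncated"
  shows "set (bc_succ \<Gamma> \<alpha>) = {V \<in> bc_polys \<Gamma>. \<alpha> \<in># bc_mset \<Gamma> V}"
proof -
  have "V \<in> set (bc_succ \<Gamma> \<alpha>) \<longleftrightarrow> V \<in> bc_polys \<Gamma> \<and> \<alpha> \<in># bc_mset \<Gamma> V" for V
  proof -
    have "V \<in> set (bc_succ \<Gamma> \<alpha>) \<longleftrightarrow> 0 < count (mset (bc_succ \<Gamma> \<alpha>)) V"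
      unfolding count_greater_zero_iff by simp
    also have "\<dots> \<longleftrightarrow> V \<in> bc_polys \<Gamma> \<and> \<alpha> \<in># bc_mset \<Gamma> V"
      unfolding count_succ[OF assms] by (simp add: occ_def)
    finally show ?thesis .
  qed
  then show ?thesis by blast
qed

lemma length_succ:
  assumes "\<alpha> \<in> nontruncated" shows "length (bc_succ \<Gamma> \<alpha>) = val \<Gamma> \<alpha>"
proof -
  have "length (bc_succ \<Gamma> \<alpha>) = size (mset (bc_succ \<Gamma> \<alpha>))" by simp
  also have "\<dots> = (\<Sum>V\<in>set (bc_succ \<Gamma> \<alpha>). count (mset (bc_succ \<Gamma> \<alpha>)) V)"
    by (simp only: size_multiset_overloaded_eq set_mset_mset)
  also have "\<dots> = (\<Sum>V\<in>bc_polys \<Gamma>. count (mset (bc_succ \<Gamma> \<alpha>)) V)"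
    by (rule sum.mono_neutral_left)
       (use finite_polys set_succ[OF assms] in \<open>auto simp: count_mset_0_iff\<close>)
  also have "\<dots> = val \<Gamma> \<alpha>"
    by (simp add: val_def count_succ[OF assms])
  finally show ?thesis .
qed

lemma arcs_Q: "arcs Q = {(\<alpha>, i). \<alpha> \<in> nontruncated \<and> i < val \<Gamma> \<alpha>}"
  by (simp add: bc_quiver_def)

lemma verts_Q: "verts Q = bc_polys \<Gamma>"
  by (simp add: bc_quiver_def)

lemma finite_arcs_Q: "finite (arcs Q)"
proof -
  have "arcs Q = (SIGMA \<alpha>:nontruncated. {..<val \<Gamma> \<alpha>})" by (auto simp: arcs_Q)
  then show ?thesis using finite_verts by simp
qed

definition stop :: "'v \<Rightarrow> nat \<Rightarrow> 'p" where
  "stop \<alpha> i = bc_succ \<Gamma> \<alpha> ! (i mod val \<Gamma> \<alpha>)"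

definition run :: "'v \<Rightarrow> nat \<Rightarrow> nat \<Rightarrow> ('v \<times> nat) list" where
  "run \<alpha> i m = map (\<lambda>j. (\<alpha>, (i + j) mod val \<Gamma> \<alpha>)) [0..<m]"

text \<open>
  Positions are read modulo the valency, so that any natural number is a starting position and
  cutting a path adds its length to the position. The path of length \<open>0\<close> is the trivial path at
  the polygon in position \<open>i\<close>: trivial paths need no separate treatment below.
\<close>

definition cyclic_path :: "'v \<Rightarrow> nat \<Rightarrow> nat \<Rightarrow> ('p, 'v \<times> nat) path" where
  "cyclic_path \<alpha> i m = (stop \<alpha> i, run \<alpha> i m, stop \<alpha> (i + m))"

lemma length_run [simp]: "length (run \<alpha> i m) = m"
  by (simp add: run_def)

lemma nth_run [simp]: "j < m \<Longrightarrow> run \<alpha> i m ! j = (\<alpha>, (i + j) mod val \<Gamma> \<alpha>)"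
  by (simp add: run_def)

lemma run_0 [simp]: "run \<alpha> i 0 = []"
  by (simp add: run_def)

lemma run_eq_Nil_iff [simp]: "run \<alpha> i m = [] \<longleftrightarrow> m = 0"
  by (simp add: run_def)

lemma run_add: "run \<alpha> i (j + k) = run \<alpha> i j @ run \<alpha> (i + j) k"
  by (rule nth_equalityI) (auto simp: nth_append add.assoc)

lemma run_1: "run \<alpha> i (Suc 0) = [(\<alpha>, i mod val \<Gamma> \<alpha>)]"
  by (simp add: run_def)

lemma run_Suc: "run \<alpha> i (Suc m) = (\<alpha>, i mod val \<Gamma> \<alpha>) # run \<alpha> (Suc i) m"
  using run_add[of \<alpha> i 1 m] by (simp add: run_1)

lemma run_cong: "i mod val \<Gamma> \<alpha> = i' mod val \<Gamma> \<alpha> \<Longrightarrow> run \<alpha> i m = run \<alpha> i' m"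
  by (rule nth_equalityI) (auto intro: mod_add_cong)

lemma stop_cong: "i mod val \<Gamma> \<alpha> = i' mod val \<Gamma> \<alpha> \<Longrightarrow> stop \<alpha> i = stop \<alpha> i'"
  by (simp add: stop_def)

lemma cyclic_path_cong:
  "i mod val \<Gamma> \<alpha> = i' mod val \<Gamma> \<alpha> \<Longrightarrow> cyclic_path \<alpha> i m = cyclic_path \<alpha> i' m"
  unfolding cyclic_path_def
  by (metis run_cong stop_cong mod_add_cong)

lemma cyclic_path_mod: "cyclic_path \<alpha> (i mod val \<Gamma> \<alpha>) m = cyclic_path \<alpha> i m"
  by (rule cyclic_path_cong) simp

lemma stop_add_full_length [simp]: "stop \<alpha> (i + full_length \<alpha>) = stop \<alpha> i"
  by (rule stop_cong) (simp add: full_length_def)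

lemma cyclic_path_0: "cyclic_path \<alpha> i 0 = (stop \<alpha> i, [], stop \<alpha> i)"
  by (simp add: cyclic_path_def)

lemma stop_in_polys:
  assumes "\<alpha> \<in> nontruncated" shows "stop \<alpha> i \<in> bc_polys \<Gamma>"
proof -
  have "stop \<alpha> i \<in> set (bc_succ \<Gamma> \<alpha>)"
    unfolding stop_def using length_succ[OF assms] val_pos assms by (intro nth_mem) auto
  then show ?thesis using set_succ[OF assms] by auto
qed

lemma tail_Q: "a \<in> arcs Q \<Longrightarrow> tail Q a = stop (fst a) (snd a)"
  by (auto simp: arcs_Q bc_quiver_def stop_def)

lemma head_Q: "a \<in> arcs Q \<Longrightarrow> head Q a = stop (fst a) (Suc (snd a))"
  by (auto simp: arcs_Q bc_quiver_def stop_def)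

lemma mod_arc: "\<alpha> \<in> nontruncated \<Longrightarrow> (\<alpha>, i mod val \<Gamma> \<alpha>) \<in> arcs Q"
  using val_pos by (auto simp: arcs_Q)

sublocale finite_vertex_quiver Q
proof
  fix a assume "a \<in> arcs Q"
  then show "tail Q a \<in> verts Q" "head Q a \<in> verts Q"
    using stop_in_polys by (auto simp: tail_Q head_Q verts_Q) (auto simp: arcs_Q)
next
  show "finite (verts Q)" using finite_polys by (simp add: verts_Q)
qed

lemma stop_Suc_mod: "stop \<alpha> (Suc (i mod val \<Gamma> \<alpha>)) = stop \<alpha> (Suc i)"
  by (rule stop_cong) (simp add: mod_Suc_eq)

lemma stop_mod: "stop \<alpha> (i mod val \<Gamma> \<alpha>) = stop \<alpha> i"
  by (rule stop_cong) simp

lemma cyclic_path_in_paths: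
  assumes \<alpha>: "\<alpha> \<in> nontruncated" shows "cyclic_path \<alpha> i m \<in> quiver_paths Q"
proof -
  have "awalk (stop \<alpha> i) (run \<alpha> i m) (stop \<alpha> (i + m))"
  proof (induction m arbitrary: i)
    case 0
    show ?case using stop_in_polys[OF \<alpha>] by (simp add: awalk_Nil_iff verts_Q)
  next
    case (Suc m)
    have a: "(\<alpha>, i mod val \<Gamma> \<alpha>) \<in> arcs Q" by (rule mod_arc[OF \<alpha>])
    show ?case
      using a Suc.IH[of "Suc i"]
      by (simp add: run_Suc awalk_Cons_iff tail_Q head_Q stop_mod stop_Suc_mod)
  qed
  then show ?thesis by (simp add: cyclic_path_def quiver_paths_iff)
qed

lemma cyclic_path_eq_iff:
  assumes "0 < m"
  shows "cyclic_path \<alpha> i m = cyclic_path \<beta> j k \<longleftrightarrow>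
    \<alpha> = \<beta> \<and> m = k \<and> i mod val \<Gamma> \<alpha> = j mod val \<Gamma> \<alpha>"
proof
  assume "cyclic_path \<alpha> i m = cyclic_path \<beta> j k"
  then have run: "run \<alpha> i m = run \<beta> j k" by (simp add: cyclic_path_def)
  from arg_cong[OF this, of length] have "m = k" by simp
  moreover have "run \<alpha> i m ! 0 = run \<beta> j k ! 0" using run by simp
  ultimately show "\<alpha> = \<beta> \<and> m = k \<and> i mod val \<Gamma> \<alpha> = j mod val \<Gamma> \<alpha>"
    using assms by auto
qed (auto intro: cyclic_path_cong)

lemma path_concat_cyclic_path:
  "path_concat (cyclic_path \<alpha> i j) (cyclic_path \<alpha> (i + j) k) = cyclic_path \<alpha> i (j + k)"
  by (simp add: cyclic_path_def run_add add.assoc)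

text \<open>
  A factorization of a path is a cut, and both pieces of a path along a successor sequence again
  run along that sequence. Therefore the coefficients of a product at cyclic paths depend on the
  coefficients of the factors at cyclic paths only.
\<close>

lemma path_factorizations_cyclic_path:
  assumes \<alpha>: "\<alpha> \<in> nontruncated"
  shows "path_factorizations Q (cyclic_path \<alpha> i m) =
    (\<lambda>k. (cyclic_path \<alpha> i k, cyclic_path \<alpha> (i + k) (m - k))) ` {..m}"
proof (intro equalityI subsetI)
  fix x assume "x \<in> path_factorizations Q (cyclic_path \<alpha> i m)"
  then obtain as v bs where x: "x = ((stop \<alpha> i, as, v), (v, bs, stop \<alpha> (i + m)))"
    and run: "run \<alpha> i m = as @ bs" and as: "awalk (stop \<alpha> i) as v"
    by (auto simp: path_factorizations_def cyclic_path_def quiver_paths_iff)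
  define k where "k = length as"
  have k: "k \<le> m" using arg_cong[OF run, of length] by (simp add: k_def)
  have "run \<alpha> i k @ run \<alpha> (i + k) (m - k) = as @ bs"
    using run run_add[of \<alpha> i k "m - k"] k by simp
  then have eq: "as = run \<alpha> i k" "bs = run \<alpha> (i + k) (m - k)" by (simp_all add: k_def)
  have "awalk (stop \<alpha> i) as (stop \<alpha> (i + k))"
    using cyclic_path_in_paths[OF \<alpha>, of i k] by (simp add: cyclic_path_def quiver_paths_iff eq(1))
  then have "v = stop \<alpha> (i + k)" using as by (metis awalkE)
  then show "x \<in> (\<lambda>k. (cyclic_path \<alpha> i k, cyclic_path \<alpha> (i + k) (m - k))) ` {..m}"
    using k by (intro image_eqI[of _ _ k]) (simp_all add: x eq cyclic_path_def)
next
  fix x assume "x \<in> (\<lambda>k. (cyclic_path \<alpha> i k, cyclic_path \<alpha> (i + k) (m - k))) ` {..m}"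
  then obtain k where "k \<le> m" "x = (cyclic_path \<alpha> i k, cyclic_path \<alpha> (i + k) (m - k))" by auto
  then show "x \<in> path_factorizations Q (cyclic_path \<alpha> i m)"
    using cyclic_path_in_paths[OF \<alpha>] path_concat_cyclic_path[of \<alpha> i k "m - k"]
    by (simp add: path_factorizations_iff) (simp add: cyclic_path_def)
qed

lemma mult_cyclic_path:
  assumes \<alpha>: "\<alpha> \<in> nontruncated"
  shows "(f \<otimes>\<^bsub>A\<^esub> g) (cyclic_path \<alpha> i m) =
    (\<Sum>k\<le>m. f (cyclic_path \<alpha> i k) * g (cyclic_path \<alpha> (i + k) (m - k)))"
proof -
  have "inj_on (\<lambda>k. (cyclic_path \<alpha> i k, cyclic_path \<alpha> (i + k) (m - k))) {..m}"
  proof (rule inj_onI)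
    fix k k' assume "(cyclic_path \<alpha> i k, cyclic_path \<alpha> (i + k) (m - k)) =
      (cyclic_path \<alpha> i k', cyclic_path \<alpha> (i + k') (m - k'))"
    then have "length (run \<alpha> i k) = length (run \<alpha> i k')" by (simp add: cyclic_path_def)
    then show "k = k'" by simp
  qed
  then show ?thesis
    by (simp add: path_algebra_simps(2) path_factorizations_cyclic_path[OF \<alpha>] sum.reindex)
qed

definition arrows_from :: "'p \<Rightarrow> ('v \<times> nat) set" where
  "arrows_from V = {a \<in> arcs Q. tail Q a = V}"

lemma arrows_from_iff:
  "a \<in> arrows_from V \<longleftrightarrow> a \<in> arcs Q \<and> stop (fst a) (snd a) = V"
  by (auto simp: arrows_from_def tail_Q)

lemma finite_arrows_from: "finite (arrows_from V)"
  using finite_arcs_Q by (simp add: arrows_from_def)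

text \<open>
  Condition (C3) gives every polygon a nontruncated vertex, hence a position in a successor
  sequence. So every trivial path is a cyclic path of length \<open>0\<close>.
\<close>

lemma arrows_from_nonempty:
  assumes V: "V \<in> bc_polys \<Gamma>" shows "arrows_from V \<noteq> {}"
proof -
  obtain \<alpha> where \<alpha>: "\<alpha> \<in># bc_mset \<Gamma> V" "val \<Gamma> \<alpha> * bc_mu \<Gamma> \<alpha> > 1" using C3[OF V] by blast
  then have n: "\<alpha> \<in> nontruncated" using polys_verts[OF V] by (auto simp: truncated_def mult.commute)
  then have "V \<in> set (bc_succ \<Gamma> \<alpha>)" using \<alpha> V by (simp add: set_succ)
  then obtain i where "i < val \<Gamma> \<alpha>" "bc_succ \<Gamma> \<alpha> ! i = V"
    by (auto simp: in_set_conv_nth length_succ[OF n])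
  then have "(\<alpha>, i) \<in> arrows_from V" using n by (auto simp: arrows_from_iff arcs_Q stop_def)
  then show ?thesis by blast
qed

text \<open>
  The power \<open>C\<^sup>\<mu>\<close> of the special cycle \<open>C\<close> whose first arrow is \<open>a\<close>.
\<close>

definition maximal_path :: "'v \<times> nat \<Rightarrow> ('p, 'v \<times> nat) path" where
  "maximal_path a = cyclic_path (fst a) (snd a) (full_length (fst a))"

lemma maximal_path_in_paths: "a \<in> arcs Q \<Longrightarrow> maximal_path a \<in> quiver_paths Q"
  by (auto simp: maximal_path_def arcs_Q intro!: cyclic_path_in_paths)

lemma fst_maximal_path: "fst (maximal_path a) = stop (fst a) (snd a)"
  by (simp add: maximal_path_def cyclic_path_def)

lemma cyclic_path_eq_maximal_path_iff:
  assumes "a \<in> arcs Q"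
  shows "cyclic_path \<alpha> i m = maximal_path a \<longleftrightarrow>
    a = (\<alpha>, i mod val \<Gamma> \<alpha>) \<and> m = full_length \<alpha>"
proof -
  obtain \<beta> j where a: "a = (\<beta>, j)" by (cases a)
  then have \<beta>: "\<beta> \<in> nontruncated" "j < val \<Gamma> \<beta>" using assms by (auto simp: arcs_Q)
  have "0 < full_length \<beta>" using full_length_gt_1[OF \<beta>(1)] by simp
  from cyclic_path_eq_iff[OF this, of \<beta> j \<alpha> i m] show ?thesis
    using \<beta> by (auto simp: maximal_path_def a)
qed

lemma inj_on_maximal_path: "inj_on maximal_path (arcs Q)"
proof (rule inj_onI)
  fix a b assume ab: "a \<in> arcs Q" "b \<in> arcs Q" "maximal_path a = maximal_path b"
  then have "cyclic_path (fst a) (snd a) (full_length (fst a)) = maximal_path b"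
    by (simp add: maximal_path_def)
  then show "a = b"
    using ab(1,2) by (simp add: cyclic_path_eq_maximal_path_iff) (auto simp: arcs_Q)
qed

text \<open>
  The maximal paths that start at \<open>V\<close> become equal in the algebra, and there they span a part of
  the socle; only the sum of their coefficients is well defined on the quotient.
\<close>

definition socle_coeff :: "'p \<Rightarrow> (('p, 'v \<times> nat) path \<Rightarrow> 'k::field) \<Rightarrow> 'k" where
  "socle_coeff V f = (\<Sum>a\<in>arrows_from V. f (maximal_path a))"

section \<open>The ideal of relations in coordinates\<close>

definition next_arrow :: "'v \<times> nat \<Rightarrow> 'v \<times> nat" where
  "next_arrow a = (fst a, Suc (snd a) mod val \<Gamma> (fst a))"

text \<open>
  The functionals that vanish here are the coordinates with respect to the basis that the quotient
  is expected to have; \<open>m = 0\<close> accounts for the classes of the trivial paths.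
\<close>

definition coordinate_kernel :: "(('p, 'v \<times> nat) path \<Rightarrow> 'k::field) set" where
  "coordinate_kernel = {f \<in> carrier A.
     (\<forall>\<alpha>\<in>nontruncated. \<forall>i m. m < full_length \<alpha> \<longrightarrow> f (cyclic_path \<alpha> i m) = 0) \<and>
     (\<forall>V\<in>bc_polys \<Gamma>. socle_coeff V f = 0)}"

lemma coordinate_kernelD:
  assumes "f \<in> coordinate_kernel"
  shows "f \<in> carrier A"
    "\<alpha> \<in> nontruncated \<Longrightarrow> m < full_length \<alpha> \<Longrightarrow> f (cyclic_path \<alpha> i m) = 0"
    "V \<in> bc_polys \<Gamma> \<Longrightarrow> socle_coeff V f = 0"
  using assms by (auto simp: coordinate_kernel_def)

lemma socle_coeff_add: "socle_coeff V (f \<oplus>\<^bsub>A\<^esub> g) = socle_coeff V f + socle_coeff V g"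
  by (simp add: socle_coeff_def path_algebra_simps sum.distrib)

lemma socle_coeff_smult: "socle_coeff V (c \<odot>\<^bsub>A\<^esub> f) = c * socle_coeff V f"
  by (simp add: socle_coeff_def path_algebra_simps sum_distrib_left)

lemma socle_coeff_minus:
  "f \<in> carrier A \<Longrightarrow> g \<in> carrier A \<Longrightarrow>
    socle_coeff V (f \<ominus>\<^bsub>A\<^esub> g) = socle_coeff V f - socle_coeff V g"
  by (simp add: socle_coeff_def path_algebra_minus sum_subtractf)

lemma arrow_source_nontruncated: "a \<in> arcs Q \<Longrightarrow> fst a \<in> nontruncated"
  by (auto simp: arcs_Q)

text \<open>
  Cutting a path of length \<open>m\<close> leaves pieces of length at most \<open>m\<close>, so the short coordinates of
  the product vanish with those of \<open>f\<close>. In the coefficient of the product at a maximal path that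
  starts at \<open>V\<close> only the cut that gives the whole path to \<open>f\<close> remains; the other factor is then the
  coefficient at the trivial path of \<open>V\<close>, the same for all these maximal paths.
\<close>

lemma kernel_mult_left:
  assumes f: "f \<in> coordinate_kernel" and g: "g \<in> carrier A"
  shows "g \<otimes>\<^bsub>A\<^esub> f \<in> coordinate_kernel"
proof -
  note fD = coordinate_kernelD[OF f]
  have 1: "(g \<otimes>\<^bsub>A\<^esub> f) (cyclic_path \<alpha> i m) = 0"
    if "\<alpha> \<in> nontruncated" "m < full_length \<alpha>" for \<alpha> i m
    unfolding mult_cyclic_path[OF that(1)] using that fD(2) by (intro sum.neutral) auto
  have "(g \<otimes>\<^bsub>A\<^esub> f) (maximal_path a) = g (V, [], V) * f (maximal_path a)"
    if a: "a \<in> arrows_from V" for a V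
  proof -
    let ?m = "full_length (fst a)"
    have n: "fst a \<in> nontruncated" and V: "stop (fst a) (snd a) = V"
      using a arrow_source_nontruncated by (auto simp: arrows_from_iff)
    have "(g \<otimes>\<^bsub>A\<^esub> f) (maximal_path a) =
      (\<Sum>k\<le>?m. g (cyclic_path (fst a) (snd a) k) * f (cyclic_path (fst a) (snd a + k) (?m - k)))"
      unfolding maximal_path_def by (rule mult_cyclic_path[OF n])
    also have "\<dots> =
      (\<Sum>k\<in>{0}. g (cyclic_path (fst a) (snd a) k) * f (cyclic_path (fst a) (snd a + k) (?m - k)))"
      using fD(2)[OF n] by (intro sum.mono_neutral_right) auto
    also have "\<dots> = g (V, [], V) * f (maximal_path a)"
      by (simp add: maximal_path_def cyclic_path_0 V)
    finally show ?thesis .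
  qed
  then have "socle_coeff V (g \<otimes>\<^bsub>A\<^esub> f) = g (V, [], V) * socle_coeff V f" for V
    unfolding socle_coeff_def sum_distrib_left by (rule sum.cong[OF refl])
  then show ?thesis
    using 1 fD(3) path_algebra_mult_closed[OF g fD(1)] by (simp add: coordinate_kernel_def)
qed

text \<open>
  The mirror image of the previous lemma; a maximal path also ends at the polygon where it starts.
\<close>

lemma kernel_mult_right:
  assumes f: "f \<in> coordinate_kernel" and g: "g \<in> carrier A"
  shows "f \<otimes>\<^bsub>A\<^esub> g \<in> coordinate_kernel"
proof -
  note fD = coordinate_kernelD[OF f]
  have 1: "(f \<otimes>\<^bsub>A\<^esub> g) (cyclic_path \<alpha> i m) = 0"
    if "\<alpha> \<in> nontruncated" "m < full_length \<alpha>" for \<alpha> i m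
    unfolding mult_cyclic_path[OF that(1)] using that fD(2) by (intro sum.neutral) auto
  have "(f \<otimes>\<^bsub>A\<^esub> g) (maximal_path a) = f (maximal_path a) * g (V, [], V)"
    if a: "a \<in> arrows_from V" for a V
  proof -
    let ?m = "full_length (fst a)"
    have n: "fst a \<in> nontruncated" and V: "stop (fst a) (snd a) = V"
      using a arrow_source_nontruncated by (auto simp: arrows_from_iff)
    have "(f \<otimes>\<^bsub>A\<^esub> g) (maximal_path a) =
      (\<Sum>k\<le>?m. f (cyclic_path (fst a) (snd a) k) * g (cyclic_path (fst a) (snd a + k) (?m - k)))"
      unfolding maximal_path_def by (rule mult_cyclic_path[OF n])
    also have "\<dots> =
      (\<Sum>k\<in>{?m}. f (cyclic_path (fst a) (snd a) k) * g (cyclic_path (fst a) (snd a + k) (?m - k)))"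
      using fD(2)[OF n] by (intro sum.mono_neutral_right) auto
    also have "\<dots> = f (maximal_path a) * g (V, [], V)"
      by (simp add: maximal_path_def cyclic_path_0 V)
    finally show ?thesis .
  qed
  then have "socle_coeff V (f \<otimes>\<^bsub>A\<^esub> g) = socle_coeff V f * g (V, [], V)" for V
    unfolding socle_coeff_def sum_distrib_right by (rule sum.cong[OF refl])
  then show ?thesis
    using 1 fD(3) path_algebra_mult_closed[OF fD(1) g] by (simp add: coordinate_kernel_def)
qed

lemma ideal_coordinate_kernel: "ideal coordinate_kernel (A :: ('k::field, _) module)"
proof (rule idealI)
  interpret A: ring A by (rule path_algebra_ring)
  show "ring A" by (rule path_algebra_ring)
  show "subgroup coordinate_kernel (add_monoid (A :: ('k, _) module))"
  proof (rule A.add.subgroupI)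
    show "coordinate_kernel \<subseteq> carrier A" by (auto simp: coordinate_kernel_def)
    have "\<zero>\<^bsub>A\<^esub> \<in> coordinate_kernel"
      using A.zero_closed by (simp add: coordinate_kernel_def socle_coeff_def path_algebra_simps(4))
    then show "coordinate_kernel \<noteq> {}" by blast
  next
    fix f :: "('p, 'v \<times> nat) path \<Rightarrow> 'k" assume f: "f \<in> coordinate_kernel"
    note fD = coordinate_kernelD[OF f]
    have "\<ominus>\<^bsub>A\<^esub> f = \<zero>\<^bsub>A\<^esub> \<ominus>\<^bsub>A\<^esub> f" using fD(1) by (simp add: a_minus_def)
    also have "\<dots> = (\<lambda>p. - f p)"
      unfolding path_algebra_minus[OF A.zero_closed fD(1)] by (simp add: path_algebra_simps)
    finally show "\<ominus>\<^bsub>A\<^esub> f \<in> coordinate_kernel"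
      using fD A.a_inv_closed[OF fD(1)] by (simp add: coordinate_kernel_def socle_coeff_def sum_negf)
  next
    fix f g :: "('p, 'v \<times> nat) path \<Rightarrow> 'k"
    assume fg: "f \<in> coordinate_kernel" "g \<in> coordinate_kernel"
    note fD = coordinate_kernelD[OF fg(1)] coordinate_kernelD[OF fg(2)]
    then show "f \<oplus>\<^bsub>A\<^esub> g \<in> coordinate_kernel"
      using A.a_closed[OF fD(1) fD(4)] socle_coeff_add[of _ f g]
      by (simp add: coordinate_kernel_def) (simp add: path_algebra_simps)
  qed
qed (auto intro: kernel_mult_left kernel_mult_right)

lemma path_elem_in_kernel:
  assumes p: "p \<in> quiver_paths Q"
    and noncyclic: "\<And>\<alpha> i m. \<alpha> \<in> nontruncated \<Longrightarrow> m \<le> full_length \<alpha> \<Longrightarrow> p \<noteq> cyclic_path \<alpha> i m"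
  shows "path_elem p \<in> (coordinate_kernel :: (_ \<Rightarrow> 'k::field) set)"
proof -
  have "maximal_path a \<noteq> p" if "a \<in> arrows_from V" for a V
    using that noncyclic[OF arrow_source_nontruncated order.refl]
    unfolding maximal_path_def arrows_from_iff by metis
  then have "socle_coeff V (path_elem p) = (0 :: 'k)" for V
    unfolding socle_coeff_def by (intro sum.neutral) (auto simp: path_elem_def)
  moreover have "path_elem p (cyclic_path \<alpha> i m) = (0 :: 'k)"
    if "\<alpha> \<in> nontruncated" "m < full_length \<alpha>" for \<alpha> i m
    using noncyclic[OF that(1) less_imp_le[OF that(2)], of i] by (auto simp: path_elem_def)
  ultimately show ?thesis
    using path_elem_closed[OF p] by (simp add: coordinate_kernel_def)
qed

lemma socle_coeff_maximal_path:
  assumes a: "a \<in> arcs Q"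
  shows "socle_coeff V (path_elem (maximal_path a)) = (if stop (fst a) (snd a) = V then 1 else 0)"
proof -
  have "socle_coeff V (path_elem (maximal_path a)) = (\<Sum>b\<in>arrows_from V. if b = a then 1 else 0)"
    unfolding socle_coeff_def path_elem_def using a inj_on_maximal_path
    by (intro sum.cong) (auto simp: arrows_from_iff inj_on_eq_iff)
  also have "\<dots> = (if a \<in> arrows_from V then 1 else 0)"
    using finite_arrows_from by simp
  finally show ?thesis using a by (simp add: arrows_from_iff)
qed

lemma maximal_path_diff_in_kernel:
  assumes a: "a \<in> arrows_from V" and b: "b \<in> arrows_from V"
  shows "path_elem (maximal_path a) \<ominus>\<^bsub>A\<^esub> path_elem (maximal_path b) \<in>
    (coordinate_kernel :: (_ \<Rightarrow> 'k::field) set)"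
proof -
  interpret A: ring A by (rule path_algebra_ring)
  have arcs: "a \<in> arcs Q" "b \<in> arcs Q" using a b by (auto simp: arrows_from_iff)
  have car: "(path_elem (maximal_path a) :: _ \<Rightarrow> 'k) \<in> carrier A"
    "(path_elem (maximal_path b) :: _ \<Rightarrow> 'k) \<in> carrier A"
    using arcs by (auto intro: path_elem_closed maximal_path_in_paths)
  have "path_elem (maximal_path c) (cyclic_path \<alpha> i m) = (0::'k)"
    if "c \<in> arcs Q" "m < full_length \<alpha>" for c \<alpha> i m
    using that by (simp add: path_elem_def cyclic_path_eq_maximal_path_iff)
  then show ?thesis
    unfolding coordinate_kernel_def
    using a b car arcs A.minus_closed[OF car]
    by (simp add: socle_coeff_minus socle_coeff_maximal_path arrows_from_iff)
       (simp add: path_algebra_minus)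
qed

lemma special_cycle_eq_run: "special_cycle \<Gamma> \<alpha> l = run \<alpha> l (val \<Gamma> \<alpha>)"
  unfolding special_cycle_def
  by (rule nth_equalityI) (auto simp: nth_rotate)

lemma cycle_power_run: "cycle_power (run \<alpha> l (val \<Gamma> \<alpha>)) k = run \<alpha> l (val \<Gamma> \<alpha> * k)"
proof (induction k)
  case 0
  then show ?case by (simp add: cycle_power_def)
next
  case (Suc k)
  have "run \<alpha> (l + val \<Gamma> \<alpha>) (val \<Gamma> \<alpha> * k) = run \<alpha> l (val \<Gamma> \<alpha> * k)"
    by (rule run_cong) simp
  with Suc show ?case
    by (simp add: cycle_power_def run_add)
qed

lemma arrows_elem_run:
  assumes \<alpha>: "\<alpha> \<in> nontruncated" and m: "0 < m"
  shows "arrows_elem Q (run \<alpha> i m) = path_elem (cyclic_path \<alpha> i m)"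
proof -
  have "hd (run \<alpha> i m) = (\<alpha>, i mod val \<Gamma> \<alpha>)" using m by (simp add: hd_conv_nth)
  moreover have "last (run \<alpha> i m) = (\<alpha>, (i + (m - 1)) mod val \<Gamma> \<alpha>)"
    using m by (simp add: last_conv_nth)
  moreover have "Suc (i + (m - 1)) = i + m" using m by simp
  ultimately show ?thesis
    using mod_arc[OF \<alpha>] unfolding arrows_elem_def cyclic_path_def
    by (simp add: tail_Q head_Q stop_mod stop_Suc_mod)
qed

lemma special_cycles_at_eq:
  assumes \<alpha>: "\<alpha> \<in> nontruncated"
  shows "special_cycles_at \<Gamma> \<alpha> V = {run \<alpha> i (val \<Gamma> \<alpha>) | i. (\<alpha>, i) \<in> arrows_from V}"
  unfolding special_cycles_at_def special_cycle_eq_run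
  using \<alpha> by (auto simp: arrows_from_iff arcs_Q stop_def)

lemma relations_one_eq:
  "(relations_one \<Gamma> :: (_ \<Rightarrow> 'k::field) set) = {path_elem (maximal_path a) \<ominus>\<^bsub>A\<^esub> path_elem (maximal_path b) | V a b.
     V \<in> bc_polys \<Gamma> \<and> a \<in> arrows_from V \<and> b \<in> arrows_from V}" (is "?L = ?R")
proof (intro equalityI subsetI)
  have elem: "arrows_elem Q (cycle_power (run \<alpha> i (val \<Gamma> \<alpha>)) (bc_mu \<Gamma> \<alpha>)) =
      (path_elem (maximal_path (\<alpha>, i)) :: _ \<Rightarrow> 'k)" if "\<alpha> \<in> nontruncated" for \<alpha> i
    using full_length_gt_1[OF that] arrows_elem_run[OF that, of "full_length \<alpha>" i]
    by (simp add: cycle_power_run maximal_path_def) (simp add: full_length_def)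
  {
    fix x assume "x \<in> ?L"
    then obtain V \<alpha> \<beta> C D where V: "V \<in> bc_polys \<Gamma>"
      and x: "x = arrows_elem Q (cycle_power C (bc_mu \<Gamma> \<alpha>))
        \<ominus>\<^bsub>A\<^esub> arrows_elem Q (cycle_power D (bc_mu \<Gamma> \<beta>))"
      and \<alpha>: "\<alpha> \<in># bc_mset \<Gamma> V" "\<alpha> \<notin> truncated \<Gamma>" "C \<in> special_cycles_at \<Gamma> \<alpha> V"
      and \<beta>: "\<beta> \<in># bc_mset \<Gamma> V" "\<beta> \<notin> truncated \<Gamma>" "D \<in> special_cycles_at \<Gamma> \<beta> V"
      unfolding relations_one_def by blast
    have n: "\<alpha> \<in> nontruncated" "\<beta> \<in> nontruncated" using \<alpha> \<beta> polys_verts[OF V] by auto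
    obtain i j where "C = run \<alpha> i (val \<Gamma> \<alpha>)" "(\<alpha>, i) \<in> arrows_from V"
      "D = run \<beta> j (val \<Gamma> \<beta>)" "(\<beta>, j) \<in> arrows_from V"
      using \<alpha>(3) \<beta>(3) n by (auto simp: special_cycles_at_eq)
    then show "x \<in> ?R"
      unfolding mem_Collect_eq using x V elem[OF n(1)] elem[OF n(2)]
      by (intro exI[of _ V] exI[of _ "(\<alpha>, i)"] exI[of _ "(\<beta>, j)"]) simp
  next
    fix x assume "x \<in> ?R"
    then obtain V \<alpha> i \<beta> j where V: "V \<in> bc_polys \<Gamma>"
      and x: "x = path_elem (maximal_path (\<alpha>, i)) \<ominus>\<^bsub>A\<^esub> path_elem (maximal_path (\<beta>, j))"
      and a: "(\<alpha>, i) \<in> arrows_from V" and b: "(\<beta>, j) \<in> arrows_from V"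
      by auto
    have n: "\<alpha> \<in> nontruncated" "\<beta> \<in> nontruncated"
      using a b by (auto simp: arrows_from_iff arcs_Q)
    have occurs: "\<gamma> \<in># bc_mset \<Gamma> V" if "(\<gamma>, k) \<in> arrows_from V" "\<gamma> \<in> nontruncated" for \<gamma> k
    proof -
      have "V = bc_succ \<Gamma> \<gamma> ! k" "k < length (bc_succ \<Gamma> \<gamma>)"
        using that by (auto simp: arrows_from_iff arcs_Q stop_def length_succ)
      then have "V \<in> set (bc_succ \<Gamma> \<gamma>)" by simp
      then show ?thesis using set_succ[OF that(2)] by blast
    qed
    show "x \<in> ?L"
      unfolding relations_one_def mem_Collect_eq
      using V n occurs[OF a n(1)] occurs[OF b n(2)] a b
      by (intro exI[of _ V] exI[of _ \<alpha>] exI[of _ \<beta>] exI[of _ "run \<alpha> i (val \<Gamma> \<alpha>)"]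
          exI[of _ "run \<beta> j (val \<Gamma> \<beta>)"])
         (auto simp: x elem special_cycles_at_eq)
  }
qed

lemma relations_two_eq:
  "(relations_two \<Gamma> :: (_ \<Rightarrow> 'k::field) set) = {path_elem (cyclic_path \<alpha> i (Suc (full_length \<alpha>))) | \<alpha> i.
     \<alpha> \<in> nontruncated \<and> i < val \<Gamma> \<alpha>}"
proof -
  have "arrows_elem Q (cycle_power (run \<alpha> i (val \<Gamma> \<alpha>)) (bc_mu \<Gamma> \<alpha>) @ [hd (run \<alpha> i (val \<Gamma> \<alpha>))])
      = (path_elem (cyclic_path \<alpha> i (Suc (full_length \<alpha>))) :: _ \<Rightarrow> 'k)" if \<alpha>: "\<alpha> \<in> nontruncated" for \<alpha> i
  proof -
    have "hd (run \<alpha> i (val \<Gamma> \<alpha>)) = (\<alpha>, i mod val \<Gamma> \<alpha>)"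
      using val_pos[of \<alpha>] \<alpha> by (simp add: hd_conv_nth)
    then have "[hd (run \<alpha> i (val \<Gamma> \<alpha>))] = run \<alpha> (i + full_length \<alpha>) 1"
      by (simp add: run_1 full_length_def)
    then have "cycle_power (run \<alpha> i (val \<Gamma> \<alpha>)) (bc_mu \<Gamma> \<alpha>) @ [hd (run \<alpha> i (val \<Gamma> \<alpha>))]
      = run \<alpha> i (Suc (full_length \<alpha>))"
      using run_add[of \<alpha> i "full_length \<alpha>" 1] by (simp add: cycle_power_run full_length_def)
    then show ?thesis using arrows_elem_run[OF \<alpha>, of "Suc (full_length \<alpha>)" i] by simp
  qed
  then have *: "x = arrows_elem Q (cycle_power (run \<alpha> i (val \<Gamma> \<alpha>)) (bc_mu \<Gamma> \<alpha>) @ [hd (run \<alpha> i (val \<Gamma> \<alpha>))])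
      \<longleftrightarrow> x = path_elem (cyclic_path \<alpha> i (Suc (full_length \<alpha>)))" if "\<alpha> \<in> nontruncated"
    for x :: "_ \<Rightarrow> 'k" and \<alpha> i
    using that by simp
  show ?thesis
    unfolding relations_two_def special_cycles_def special_cycle_eq_run
    using * by blast
qed

lemma run_2: "run \<alpha> i 2 = [(\<alpha>, i mod val \<Gamma> \<alpha>), next_arrow (\<alpha>, i mod val \<Gamma> \<alpha>)]"
  by (simp add: run_Suc numeral_2_eq_2 next_arrow_def mod_Suc_eq)

text \<open>
  The paths of length two that the relations of type three spare are those that continue along a
  successor sequence. A special cycle of length one contains no path of length two, which is why
  the square of its loop has to be exempted separately.
\<close>

lemma special_or_loop_iff_next_arrow:
  assumes a: "a \<in> arcs Q" and b: "b \<in> arcs Q"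
  shows "(\<exists>\<alpha>\<in>nontruncated. \<exists>C\<in>special_cycles \<Gamma> \<alpha>. sublist [a, b] C) \<or>
      (a = b \<and> val \<Gamma> (fst a) = 1 \<and> bc_mu \<Gamma> (fst a) > 1) \<longleftrightarrow> b = next_arrow a" (is "?L \<longleftrightarrow> ?R")
proof
  obtain \<alpha> i where ai: "a = (\<alpha>, i)" by (cases a)
  have \<alpha>: "\<alpha> \<in> nontruncated" "i < val \<Gamma> \<alpha>" using a by (auto simp: ai arcs_Q)
  show ?R if ?L
    using that
  proof
    assume "\<exists>\<alpha>\<in>nontruncated. \<exists>C\<in>special_cycles \<Gamma> \<alpha>. sublist [a, b] C"
    then obtain \<beta> C where "C \<in> special_cycles \<Gamma> \<beta>" and sub: "sublist [a, b] C" by blast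
    then obtain l where C: "C = run \<beta> l (val \<Gamma> \<beta>)"
      by (auto simp: special_cycles_def special_cycle_eq_run)
    obtain xs ys where "run \<beta> l (val \<Gamma> \<beta>) = xs @ [a, b] @ ys"
      using sub unfolding sublist_def C by blast
    moreover from arg_cong[OF this, of length] have "Suc (length xs) < val \<Gamma> \<beta>" by simp
    moreover have "(xs @ [a, b] @ ys) ! length xs = a" "(xs @ [a, b] @ ys) ! Suc (length xs) = b"
      by (simp_all add: nth_append)
    ultimately have "a = (\<beta>, (l + length xs) mod val \<Gamma> \<beta>)" "b = (\<beta>, (l + Suc (length xs)) mod val \<Gamma> \<beta>)"
      by (metis Suc_lessD nth_run)+
    then show ?R by (simp add: next_arrow_def mod_Suc_eq)
  next
    assume "a = b \<and> val \<Gamma> (fst a) = 1 \<and> bc_mu \<Gamma> (fst a) > 1"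
    then show ?R using \<alpha>(2) by (auto simp: ai next_arrow_def)
  qed
  show ?L if ?R
  proof (cases "val \<Gamma> \<alpha> = 1")
    case True
    then have "bc_mu \<Gamma> \<alpha> > 1" using nontruncated_cases[OF \<alpha>(1)] by auto
    then show ?thesis using True that \<alpha> by (auto simp: ai next_arrow_def)
  next
    case False
    then have "val \<Gamma> \<alpha> = 2 + (val \<Gamma> \<alpha> - 2)" using \<alpha>(2) by simp
    then have "run \<alpha> i (val \<Gamma> \<alpha>) = run \<alpha> i 2 @ run \<alpha> (i + 2) (val \<Gamma> \<alpha> - 2)"
      by (metis run_add)
    also have "run \<alpha> i 2 = [a, b]" using that \<alpha>(2) by (simp add: run_2 ai)
    finally have "sublist [a, b] (run \<alpha> i (val \<Gamma> \<alpha>))"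
      unfolding sublist_def by (metis append_Nil)
    then show ?thesis using \<alpha> by (auto simp: special_cycles_def special_cycle_eq_run)
  qed
qed

lemma relations_three_eq:
  "relations_three \<Gamma> = {path_elem (tail Q a, [a, b], head Q b) | a b.
     a \<in> arcs Q \<and> b \<in> arcs Q \<and> head Q a = tail Q b \<and> b \<noteq> next_arrow a}"
proof -
  have "a \<in> arcs Q \<and> b \<in> arcs Q \<and> head Q a = tail Q b \<and>
      \<not> (\<exists>\<alpha>\<in>nontruncated. \<exists>C\<in>special_cycles \<Gamma> \<alpha>. sublist [a, b] C) \<and>
      \<not> (a = b \<and> val \<Gamma> (fst a) = 1 \<and> bc_mu \<Gamma> (fst a) > 1) \<longleftrightarrow>
    a \<in> arcs Q \<and> b \<in> arcs Q \<and> head Q a = tail Q b \<and> b \<noteq> next_arrow a" for a b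
    using special_or_loop_iff_next_arrow[of a b] by blast
  then show ?thesis
    unfolding relations_three_def arrows_elem_def by simp
qed

lemma relations_in_kernel:
  "relations_one \<Gamma> \<union> relations_two \<Gamma> \<union> relations_three \<Gamma> \<subseteq> coordinate_kernel"
proof (intro Un_least subsetI)
  fix x assume "x \<in> relations_one \<Gamma>"
  then show "x \<in> coordinate_kernel"
    unfolding relations_one_eq using maximal_path_diff_in_kernel by blast
next
  fix x assume "x \<in> relations_two \<Gamma>"
  then obtain \<alpha> i where \<alpha>: "\<alpha> \<in> nontruncated"
    and x: "x = path_elem (cyclic_path \<alpha> i (Suc (full_length \<alpha>)))"
    unfolding relations_two_eq by blast
  show "x \<in> coordinate_kernel"
    unfolding x by (rule path_elem_in_kernel[OF cyclic_path_in_paths[OF \<alpha>]])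
      (auto simp: cyclic_path_eq_iff)
next
  fix x assume "x \<in> relations_three \<Gamma>"
  then obtain a b where a: "a \<in> arcs Q" and b: "b \<in> arcs Q" and ab: "head Q a = tail Q b"
    "b \<noteq> next_arrow a" and x: "x = path_elem (tail Q a, [a, b], head Q b)"
    unfolding relations_three_eq by blast
  show "x \<in> coordinate_kernel"
    unfolding x
  proof (rule path_elem_in_kernel)
    show "(tail Q a, [a, b], head Q b) \<in> quiver_paths Q"
      using a b ab by (simp add: quiver_paths_iff awalk_simps)
    fix \<alpha> i m
    show "(tail Q a, [a, b], head Q b) \<noteq> cyclic_path \<alpha> i m"
    proof
      assume "(tail Q a, [a, b], head Q b) = cyclic_path \<alpha> i m"
      then have run: "run \<alpha> i m = [a, b]" by (simp add: cyclic_path_def)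
      from arg_cong[OF this, of length] have "m = 2" by simp
      with run have "b = next_arrow a" by (auto simp: run_2)
      with ab show False by simp
    qed
  qed
qed

text \<open>
  Either a path follows one successor sequence from its first arrow on, or at some point the next
  arrow is not the one prescribed by the sequence; the latter makes it a multiple of a relation of
  type three.
\<close>

lemma path_is_run_or_has_turn:
  assumes "awalk u as v" "as \<noteq> []"
  shows "(\<exists>\<alpha>\<in>nontruncated. \<exists>i. as = run \<alpha> i (length as)) \<or>
    (\<exists>xs a b ys. as = xs @ [a, b] @ ys \<and> b \<noteq> next_arrow a)"
  using assms
proof (induction as arbitrary: u)
  case Nil
  then show ?case by simp
next
  case (Cons a as)
  have a: "a \<in> arcs Q" using Cons.prems by (simp add: awalk_Cons_iff)
  obtain \<alpha> i where ai: "a = (\<alpha>, i)" by (cases a)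
  have \<alpha>: "\<alpha> \<in> nontruncated" "i < val \<Gamma> \<alpha>" using a by (auto simp: ai arcs_Q)
  show ?case
  proof (cases as)
    case Nil
    then have "a # as = run \<alpha> i (length (a # as))" using \<alpha>(2) by (simp add: run_1 ai)
    then show ?thesis using \<alpha>(1) by blast
  next
    case (Cons b bs)
    have "awalk (head Q a) as v" using Cons.prems by (simp add: awalk_Cons_iff)
    then consider \<beta> j where "\<beta> \<in> nontruncated" "as = run \<beta> j (length as)"
      | xs c d ys where "as = xs @ [c, d] @ ys" "d \<noteq> next_arrow c"
      using Cons.IH[of "head Q a"] Cons by blast
    then show ?thesis
    proof cases
      case 1
      show ?thesis
      proof (cases "b = next_arrow a")
        case False
        then show ?thesis using Cons by (metis append_Cons append_Nil)
      next
        case True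
        have "b = run \<beta> j (length as) ! 0" using 1(2) Cons by (metis nth_Cons_0)
        then have "b = (\<beta>, j mod val \<Gamma> \<beta>)" using Cons by simp
        with True have "\<beta> = \<alpha>" "j mod val \<Gamma> \<alpha> = Suc i mod val \<Gamma> \<alpha>"
          by (auto simp: next_arrow_def ai)
        then have "run \<beta> j (length as) = run \<alpha> (Suc i) (length as)" by (auto intro: run_cong)
        then have "a # as = run \<alpha> i (length (a # as))"
          using 1(2) \<alpha>(2) by (simp add: run_Suc ai)
        then show ?thesis using \<alpha>(1) by blast
      qed
    next
      case 2
      then have "a # as = (a # xs) @ [c, d] @ ys" by simp
      then show ?thesis using 2(2) by blast
    qed
  qed
qed

lemma finite_support: "f \<in> carrier A \<Longrightarrow> finite {p. f p \<noteq> 0}"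
  by (simp add: path_algebra_simps)

context
  fixes I :: "(('p, 'v \<times> nat) path \<Rightarrow> 'k::field) set"
  assumes I: "ideal I A"
    and relations: "relations_one \<Gamma> \<subseteq> I" "relations_two \<Gamma> \<subseteq> I" "relations_three \<Gamma> \<subseteq> I"
begin

text \<open>
  The first \<open>full_length \<alpha> + 1\<close> arrows of such a path form a relation of type two.
\<close>

lemma long_cyclic_path_in_ideal:
  assumes \<alpha>: "\<alpha> \<in> nontruncated" and m: "full_length \<alpha> < m"
  shows "path_elem (cyclic_path \<alpha> i m) \<in> I"
proof -
  let ?l = "Suc (full_length \<alpha>)"
  have "path_elem (cyclic_path \<alpha> (i mod val \<Gamma> \<alpha>) ?l) \<in> relations_two \<Gamma>"
    unfolding relations_two_eq mem_Collect_eq using val_pos[of \<alpha>] \<alpha>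
    by (intro exI[of _ \<alpha>] exI[of _ "i mod val \<Gamma> \<alpha>"]) auto
  then have q: "path_elem (cyclic_path \<alpha> i ?l) \<in> I"
    using relations(2) unfolding cyclic_path_mod by (rule subsetD[rotated])
  have "path_elem (path_concat (cyclic_path \<alpha> i 0)
      (path_concat (cyclic_path \<alpha> i ?l) (cyclic_path \<alpha> (i + ?l) (m - ?l)))) \<in> I"
    by (rule ideal_path_elem_concat[OF I q]) (use \<alpha> in \<open>auto simp: cyclic_path_in_paths\<close>,
        auto simp: cyclic_path_def)
  then show ?thesis
    using m path_concat_cyclic_path[of \<alpha> i ?l "m - ?l"] path_concat_cyclic_path[of \<alpha> i 0 m]
    by simp
qed

lemma turning_path_in_ideal:
  assumes path: "(u, xs @ [a, b] @ ys, v) \<in> quiver_paths Q" and turn: "b \<noteq> next_arrow a"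
  shows "path_elem (u, xs @ [a, b] @ ys, v) \<in> I"
proof -
  have w: "awalk u (xs @ [a, b] @ ys) v" using path by (simp add: quiver_paths_iff)
  obtain w1 w2 where w12: "awalk u xs w1" "awalk w1 [a, b] w2" "awalk w2 ys v"
    using w unfolding awalk_append_iff by blast
  then have ab: "a \<in> arcs Q" "b \<in> arcs Q" "head Q a = tail Q b" "w1 = tail Q a" "w2 = head Q b"
    by (auto simp: awalk_simps)
  have q: "path_elem (w1, [a, b], w2) \<in> I"
    using relations(3) ab turn unfolding relations_three_eq by blast
  have "path_elem (path_concat (u, xs, w1) (path_concat (w1, [a, b], w2) (w2, ys, v))) \<in> I"
    by (rule ideal_path_elem_concat[OF I q]) (use w12 in \<open>auto simp: quiver_paths_iff\<close>)
  then show ?thesis by simp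
qed

text \<open>
  Such a path is neither trivial nor a cyclic path shorter than a maximal one, since \<open>f\<close> vanishes
  at these; so it is too long or it turns.
\<close>

lemma nonmaximal_path_in_ideal:
  assumes f: "f \<in> coordinate_kernel" and p: "f p \<noteq> 0" "p \<notin> maximal_path ` arcs Q"
  shows "path_elem p \<in> I"
proof -
  note fD = coordinate_kernelD[OF f]
  have pP: "p \<in> quiver_paths Q" using path_algebra_eval_outside[OF fD(1)] p(1) by blast
  obtain u as v where puv: "p = (u, as, v)" by (cases p) auto
  have w: "awalk u as v" using pP by (simp add: puv quiver_paths_iff)
  have "as \<noteq> []"
  proof
    assume "as = []"
    with w have uv: "v = u" "u \<in> bc_polys \<Gamma>" by (auto simp: awalk_Nil_iff verts_Q)
    then obtain a where a: "a \<in> arrows_from u" using arrows_from_nonempty by blast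
    then have n: "fst a \<in> nontruncated" "stop (fst a) (snd a) = u"
      using arrow_source_nontruncated by (auto simp: arrows_from_iff)
    have "f (cyclic_path (fst a) (snd a) 0) = 0"
      using fD(2)[OF n(1)] full_length_gt_1[OF n(1)] by simp
    then show False using p(1) uv \<open>as = []\<close> by (simp add: cyclic_path_0 n(2) puv)
  qed
  from path_is_run_or_has_turn[OF w this] show ?thesis
  proof
    assume "\<exists>\<alpha>\<in>nontruncated. \<exists>i. as = run \<alpha> i (length as)"
    then obtain \<alpha> i where \<alpha>: "\<alpha> \<in> nontruncated" and as: "as = run \<alpha> i (length as)" by blast
    define m where "m = length as"
    have as': "as = run \<alpha> i m" using as by (simp add: m_def)
    have "awalk (stop \<alpha> i) as (stop \<alpha> (i + m))"
      using cyclic_path_in_paths[OF \<alpha>, of i m] by (simp add: cyclic_path_def quiver_paths_iff as')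
    with w \<open>as \<noteq> []\<close> have "u = stop \<alpha> i" "v = stop \<alpha> (i + m)"
      using awalk_verts_ne_eq[of as u "stop \<alpha> i"] by (metis awalkE)+
    then have pc: "p = cyclic_path \<alpha> i m" by (simp add: puv cyclic_path_def as')
    have "\<not> m < full_length \<alpha>" using fD(2)[OF \<alpha>] p(1) pc by auto
    moreover have "m \<noteq> full_length \<alpha>"
    proof
      assume "m = full_length \<alpha>"
      then have "p = maximal_path (\<alpha>, i mod val \<Gamma> \<alpha>)"
        by (simp add: pc maximal_path_def cyclic_path_mod)
      then show False using p(2) mod_arc[OF \<alpha>] by blast
    qed
    ultimately show ?thesis using long_cyclic_path_in_ideal[OF \<alpha>] by (simp add: pc)
  next
    assume "\<exists>xs a b ys. as = xs @ [a, b] @ ys \<and> b \<noteq> next_arrow a"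
    then show ?thesis using turning_path_in_ideal pP unfolding puv by blast
  qed
qed

text \<open>
  Write \<open>f\<close> as the combination of the paths in its support and subtract from every maximal path
  that starts at \<open>V\<close> a maximal path at \<open>V\<close> chosen once and for all. In total this subtracts the
  chosen path with coefficient \<open>socle_coeff V f\<close>, which is zero, and now every summand lies in the
  ideal: the differences of maximal paths by the relations of type one, all other paths by those of
  types two and three.
\<close>

lemma coordinate_kernel_subset_ideal: "coordinate_kernel \<subseteq> I"
proof
  fix f :: "('p, 'v \<times> nat) path \<Rightarrow> 'k" assume f: "f \<in> coordinate_kernel"
  note fD = coordinate_kernelD[OF f]
  define T where "T = {p. f p \<noteq> 0}"
  define M where "M = maximal_path ` arcs Q"
  define rep where "rep V = maximal_path (SOME a. a \<in> arrows_from V)" for V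
  \<comment> \<open>The summand of the path \<open>q\<close> after subtracting the chosen maximal path.\<close>
  define h :: "_ \<Rightarrow> _ \<Rightarrow> 'k" where
    "h q = (\<lambda>p. f q * (path_elem q p - (if q \<in> M then path_elem (rep (fst q)) p else 0)))" for q
  have finT: "finite T" unfolding T_def by (rule finite_support[OF fD(1)])
  have rep: "\<exists>a\<in>arrows_from V. rep V = maximal_path a" if "V \<in> bc_polys \<Gamma>" for V
    unfolding rep_def using some_in_eq[of "arrows_from V"] arrows_from_nonempty[OF that] by blast
  have fst_rep: "fst (rep V) = V" if "V \<in> bc_polys \<Gamma>" for V
    using rep[OF that] by (auto simp: fst_maximal_path arrows_from_iff)
  have fst_M: "fst q \<in> bc_polys \<Gamma>" if "q \<in> M" for q
    using that stop_in_polys arrow_source_nontruncated by (auto simp: M_def fst_maximal_path)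
  have M_fibre: "{q \<in> M. fst q = V} = maximal_path ` arrows_from V" for V
    by (auto simp: M_def fst_maximal_path arrows_from_iff)
  have h_in: "h q \<in> I" if q: "q \<in> T" for q
  proof (cases "q \<in> M")
    case True
    then have V: "fst q \<in> bc_polys \<Gamma>" by (rule fst_M)
    obtain a where a: "a \<in> arrows_from (fst q)" "q = maximal_path a"
      using True M_fibre[of "fst q"] by blast
    obtain b where b: "b \<in> arrows_from (fst q)" "rep (fst q) = maximal_path b" using rep[OF V] by blast
    have "path_elem (maximal_path a) \<ominus>\<^bsub>A\<^esub> path_elem (maximal_path b) \<in>
        (relations_one \<Gamma> :: (_ \<Rightarrow> 'k) set)"
      unfolding relations_one_eq mem_Collect_eq using V a(1) b(1)
      by (intro exI[of _ "fst q"] exI[of _ a] exI[of _ b]) auto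
    then have "path_elem q \<ominus>\<^bsub>A\<^esub> path_elem (rep (fst q)) \<in> I"
      using relations(1) unfolding b(2) a(2)[symmetric] by (rule subsetD[rotated])
    moreover have "path_elem q \<ominus>\<^bsub>A\<^esub> path_elem (rep (fst q)) =
        (\<lambda>p. path_elem q p - path_elem (rep (fst q)) p :: 'k)"
    proof (rule path_algebra_minus)
      show "path_elem q \<in> carrier A" "path_elem (rep (fst q)) \<in> carrier A"
        unfolding b(2) using a b
        by (metis path_elem_closed maximal_path_in_paths arrows_from_iff)+
    qed
    ultimately have "(\<lambda>p. path_elem q p - path_elem (rep (fst q)) p) \<in> I" by (simp only:)
    from ideal_smult_closed[OF I this, of "f q"] show ?thesis using True by (simp add: h_def)
  next
    case False
    then have "path_elem q \<in> I"
      using nonmaximal_path_in_ideal[OF f, of q] q by (simp add: T_def M_def)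
    from ideal_smult_closed[OF I this, of "f q"] show ?thesis using False by (simp add: h_def)
  qed
  have "(\<Sum>q\<in>T. h q p) = f p" for p
  proof -
    have "(\<Sum>q\<in>T. f q * path_elem q p) = (\<Sum>q\<in>T. if q = p then f q else 0)"
      by (rule sum.cong) (auto simp: path_elem_def)
    also have "\<dots> = f p" using finT by (simp add: T_def)
    finally have 1: "(\<Sum>q\<in>T. f q * path_elem q p) = f p" .
    have 2: "(\<Sum>q\<in>T. f q * (if q \<in> M then path_elem (rep (fst q)) p else 0)) = 0"
    proof (cases "\<exists>V\<in>bc_polys \<Gamma>. p = rep V")
      case False
      then show ?thesis using fst_M by (intro sum.neutral) (auto simp: path_elem_def)
    next
      case True
      then obtain V where V: "V \<in> bc_polys \<Gamma>" "p = rep V" by blast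
      have rep_eq: "p = rep (fst q) \<longleftrightarrow> fst q = V" if "q \<in> M" for q
        using fst_rep[OF fst_M[OF that]] fst_rep[OF V(1)] V(2) by metis
      have "(\<Sum>q\<in>T. f q * (if q \<in> M then path_elem (rep (fst q)) p else 0)) =
          (\<Sum>q\<in>T. if q \<in> {q \<in> M. fst q = V} then f q else 0)"
        by (rule sum.cong[OF refl]) (simp add: path_elem_def rep_eq flip: V(2))
      also have "\<dots> = (\<Sum>q\<in>T \<inter> {q \<in> M. fst q = V}. f q)"
        by (rule sum.inter_restrict[OF finT, symmetric])
      also have "\<dots> = (\<Sum>q\<in>{q \<in> M. fst q = V}. f q)"
        unfolding M_fibre using finite_arrows_from
        by (intro sum.mono_neutral_left) (auto simp: T_def)
      also have "\<dots> = socle_coeff V f"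
        unfolding M_fibre socle_coeff_def
        by (subst sum.reindex) (auto intro: inj_on_subset[OF inj_on_maximal_path] simp: arrows_from_def)
      also have "\<dots> = 0" by (rule fD(3)[OF V(1)])
      finally show ?thesis .
    qed
    show ?thesis
      using 1 2 by (simp add: h_def right_diff_distrib sum_subtractf)
  qed
  then have "f = (\<lambda>p. \<Sum>q\<in>T. h q p)" by auto
  also have "\<dots> \<in> I" by (rule ideal_sum_closed[OF I finT h_in])
  finally show "f \<in> I" .
qed

end

text \<open>
  Equality in the Brauer configuration algebra is therefore equality of coordinates.
\<close>

theorem bc_ideal_eq_coordinate_kernel: "bc_ideal \<Gamma> = coordinate_kernel"
proof
  interpret A: ring A by (rule path_algebra_ring)
  let ?S = "relations_one \<Gamma> \<union> relations_two \<Gamma> \<union> relations_three \<Gamma>"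
  show "bc_ideal \<Gamma> \<subseteq> coordinate_kernel"
    unfolding bc_ideal_def
    by (rule A.genideal_minimal[OF ideal_coordinate_kernel relations_in_kernel])
  have S: "?S \<subseteq> carrier A"
    using relations_in_kernel coordinate_kernelD(1) by blast
  have "ideal (bc_ideal \<Gamma>) A" unfolding bc_ideal_def by (rule A.genideal_ideal[OF S])
  moreover have "?S \<subseteq> bc_ideal \<Gamma>" unfolding bc_ideal_def by (rule A.genideal_self[OF S])
  ultimately show "coordinate_kernel \<subseteq> bc_ideal \<Gamma>"
    by (intro coordinate_kernel_subset_ideal) auto
qed

section \<open>Central elements\<close>

sublocale Lambda: quotient_algebra "A :: ('k::field, _) module" coordinate_kernel
  by (intro quotient_algebra.intro quotient_algebra_axioms.intro path_algebra_ring
      ideal_coordinate_kernel path_algebra_module path_algebra_smult_mult)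

lemma brauer_algebra_eq: "brauer_algebra \<Gamma> = quot_algebra A coordinate_kernel"
  by (simp add: brauer_algebra_def bc_ideal_eq_coordinate_kernel)

lemma diff_in_kernel_iff:
  assumes "f \<in> carrier A" "g \<in> carrier A"
  shows "f \<ominus>\<^bsub>A\<^esub> g \<in> coordinate_kernel \<longleftrightarrow>
    (\<forall>\<alpha>\<in>nontruncated. \<forall>i m. m < full_length \<alpha> \<longrightarrow> f (cyclic_path \<alpha> i m) = g (cyclic_path \<alpha> i m)) \<and>
    (\<forall>V\<in>bc_polys \<Gamma>. socle_coeff V f = socle_coeff V g)"
proof -
  have "f \<ominus>\<^bsub>A\<^esub> g \<in> carrier A" using assms by (rule Lambda.A.minus_closed)
  then show ?thesis
    unfolding coordinate_kernel_def mem_Collect_eq socle_coeff_minus[OF assms]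
    by (simp add: path_algebra_minus[OF assms])
qed

lemma commutator_in_kernelI:
  assumes "f \<in> carrier A" "g \<in> carrier A"
    and "\<And>\<alpha> i m. \<alpha> \<in> nontruncated \<Longrightarrow> m < full_length \<alpha> \<Longrightarrow>
      (f \<otimes>\<^bsub>A\<^esub> g) (cyclic_path \<alpha> i m) = (g \<otimes>\<^bsub>A\<^esub> f) (cyclic_path \<alpha> i m)"
    and "\<And>V. V \<in> bc_polys \<Gamma> \<Longrightarrow> socle_coeff V (f \<otimes>\<^bsub>A\<^esub> g) = socle_coeff V (g \<otimes>\<^bsub>A\<^esub> f)"
  shows "f \<otimes>\<^bsub>A\<^esub> g \<ominus>\<^bsub>A\<^esub> g \<otimes>\<^bsub>A\<^esub> f \<in> coordinate_kernel"
  using assms by (simp add: diff_in_kernel_iff path_algebra_mult_closed)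

lemma path_elem_cyclic_path:
  assumes "0 < d"
  shows "path_elem (cyclic_path \<alpha> i d) (cyclic_path \<beta> j m) =
    (if \<beta> = \<alpha> \<and> m = d \<and> i mod val \<Gamma> \<alpha> = j mod val \<Gamma> \<alpha> then 1 else 0)"
  using cyclic_path_eq_iff[OF assms, of \<alpha> i \<beta> j m] by (auto simp: path_elem_def)

text \<open>
  Of all cuts of the path from position \<open>j\<close> only the one after \<open>d\<close> arrows contributes, and only
  if its first piece is the given path.
\<close>

lemma path_elem_mult_cyclic_path:
  assumes \<beta>: "\<beta> \<in> nontruncated" and d: "0 < d"
  shows "(path_elem (cyclic_path \<alpha> i d) \<otimes>\<^bsub>A\<^esub> f) (cyclic_path \<beta> j m) =
    (if \<beta> = \<alpha> \<and> d \<le> m \<and> i mod val \<Gamma> \<alpha> = j mod val \<Gamma> \<alpha> then f (cyclic_path \<alpha> (i + d) (m - d)) else 0)"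
proof -
  have "(path_elem (cyclic_path \<alpha> i d) \<otimes>\<^bsub>A\<^esub> f) (cyclic_path \<beta> j m) =
    (\<Sum>k\<le>m. if k = d then
       (if \<beta> = \<alpha> \<and> i mod val \<Gamma> \<alpha> = j mod val \<Gamma> \<alpha> then f (cyclic_path \<beta> (j + d) (m - d)) else 0) else 0)"
    unfolding mult_cyclic_path[OF \<beta>] by (rule sum.cong) (simp_all add: path_elem_cyclic_path[OF d])
  moreover have "cyclic_path \<alpha> (j + d) (m - d) = cyclic_path \<alpha> (i + d) (m - d)"
    if "i mod val \<Gamma> \<alpha> = j mod val \<Gamma> \<alpha>"
    using that by (intro cyclic_path_cong) (metis mod_add_left_eq)
  ultimately show ?thesis by auto
qed

lemma mult_path_elem_cyclic_path:
  assumes \<beta>: "\<beta> \<in> nontruncated" and d: "0 < d"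
  shows "(f \<otimes>\<^bsub>A\<^esub> path_elem (cyclic_path \<alpha> i d)) (cyclic_path \<beta> j m) =
    (if \<beta> = \<alpha> \<and> d \<le> m \<and> i mod val \<Gamma> \<alpha> = (j + (m - d)) mod val \<Gamma> \<alpha>
     then f (cyclic_path \<alpha> j (m - d)) else 0)"
proof -
  have "(f \<otimes>\<^bsub>A\<^esub> path_elem (cyclic_path \<alpha> i d)) (cyclic_path \<beta> j m) =
    (\<Sum>k\<le>m. if k = m - d then
       (if \<beta> = \<alpha> \<and> d \<le> m \<and> i mod val \<Gamma> \<alpha> = (j + (m - d)) mod val \<Gamma> \<alpha>
        then f (cyclic_path \<beta> j (m - d)) else 0) else 0)"
    unfolding mult_cyclic_path[OF \<beta>]
  proof (rule sum.cong[OF refl])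
    fix k assume "k \<in> {..m}"
    then have "m - k = d \<longleftrightarrow> k = m - d \<and> d \<le> m" by auto
    then show "f (cyclic_path \<beta> j k) * path_elem (cyclic_path \<alpha> i d) (cyclic_path \<beta> (j + k) (m - k)) =
      (if k = m - d then
       (if \<beta> = \<alpha> \<and> d \<le> m \<and> i mod val \<Gamma> \<alpha> = (j + (m - d)) mod val \<Gamma> \<alpha>
        then f (cyclic_path \<beta> j (m - d)) else 0) else 0)"
      by (auto simp: path_elem_cyclic_path[OF d])
  qed
  then show ?thesis by auto
qed

lemma trivial_path_in_paths: "V \<in> bc_polys \<Gamma> \<Longrightarrow> (V, [], V) \<in> quiver_paths Q"
  by (simp add: quiver_paths_iff awalk_Nil_iff verts_Q)

lemma trivial_mult_cyclic_path:
  assumes \<beta>: "\<beta> \<in> nontruncated"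
  shows "(path_elem (V, [], V) \<otimes>\<^bsub>A\<^esub> f) (cyclic_path \<beta> j m) =
    (if stop \<beta> j = V then f (cyclic_path \<beta> j m) else 0)"
proof -
  have "(path_elem (V, [], V) \<otimes>\<^bsub>A\<^esub> f) (cyclic_path \<beta> j m) =
    (\<Sum>k\<le>m. if k = 0 then (if stop \<beta> j = V then f (cyclic_path \<beta> j m) else 0) else 0)"
    unfolding mult_cyclic_path[OF \<beta>]
    by (rule sum.cong) (auto simp: path_elem_def cyclic_path_def)
  then show ?thesis by simp
qed

lemma mult_trivial_cyclic_path:
  assumes \<beta>: "\<beta> \<in> nontruncated"
  shows "(f \<otimes>\<^bsub>A\<^esub> path_elem (V, [], V)) (cyclic_path \<beta> j m) =
    (if stop \<beta> (j + m) = V then f (cyclic_path \<beta> j m) else 0)"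
proof -
  have "(f \<otimes>\<^bsub>A\<^esub> path_elem (V, [], V)) (cyclic_path \<beta> j m) =
    (\<Sum>k\<le>m. if k = m then (if stop \<beta> (j + m) = V then f (cyclic_path \<beta> j m) else 0) else 0)"
    unfolding mult_cyclic_path[OF \<beta>]
    by (rule sum.cong) (auto simp: path_elem_def cyclic_path_def)
  then show ?thesis by simp
qed

text \<open>
  The sum of the \<open>k\<close>-th powers of all special \<open>\<alpha>\<close>-cycles, written as the indicator function of
  these paths.
\<close>

definition cycle_sum :: "'v \<Rightarrow> nat \<Rightarrow> ('p, 'v \<times> nat) path \<Rightarrow> 'k::field" where
  "cycle_sum \<alpha> k p = (if \<exists>i. p = cyclic_path \<alpha> i (k * val \<Gamma> \<alpha>) then 1 else 0)"

lemma cycle_sum_closed: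
  assumes \<alpha>: "\<alpha> \<in> nontruncated" shows "cycle_sum \<alpha> k \<in> carrier A"
proof -
  have "{p. cycle_sum \<alpha> k p \<noteq> (0::'a)} \<subseteq> (\<lambda>i. cyclic_path \<alpha> i (k * val \<Gamma> \<alpha>)) ` {..<val \<Gamma> \<alpha>}"
  proof
    fix p assume "p \<in> {p. cycle_sum \<alpha> k p \<noteq> (0::'a)}"
    then obtain i where "p = cyclic_path \<alpha> i (k * val \<Gamma> \<alpha>)"
      by (auto simp: cycle_sum_def split: if_splits)
    then have "p = cyclic_path \<alpha> (i mod val \<Gamma> \<alpha>) (k * val \<Gamma> \<alpha>)" by (simp add: cyclic_path_mod)
    then show "p \<in> (\<lambda>i. cyclic_path \<alpha> i (k * val \<Gamma> \<alpha>)) ` {..<val \<Gamma> \<alpha>}"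
      using val_pos[of \<alpha>] \<alpha> by auto
  qed
  then have "finite {p. cycle_sum \<alpha> k p \<noteq> (0::'a)}" by (rule finite_subset) simp
  then show ?thesis
    using cyclic_path_in_paths[OF \<alpha>]
    by (auto simp: path_algebra_simps cycle_sum_def split: if_splits)
qed

lemma cycle_sum_cyclic_path:
  assumes "0 < k" "\<alpha> \<in> nontruncated"
  shows "cycle_sum \<alpha> k (cyclic_path \<beta> j m) = (if \<beta> = \<alpha> \<and> m = k * val \<Gamma> \<alpha> then 1 else 0)"
proof -
  have "0 < k * val \<Gamma> \<alpha>" using assms val_pos[of \<alpha>] by simp
  then have "(\<exists>i. cyclic_path \<beta> j m = cyclic_path \<alpha> i (k * val \<Gamma> \<alpha>)) \<longleftrightarrow> \<beta> = \<alpha> \<and> m = k * val \<Gamma> \<alpha>"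
    using cyclic_path_eq_iff[of "k * val \<Gamma> \<alpha>" \<alpha> _ \<beta> j m] by metis
  then show ?thesis by (simp add: cycle_sum_def)
qed

text \<open>
  Multiplication by this sum, on either side, removes \<open>k\<close> full turns from the path at which a
  coefficient is taken. A full turn leads back to its starting position, so it does not matter
  whether it is removed at the beginning or at the end.
\<close>

lemma cycle_sum_central:
  assumes \<alpha>: "\<alpha> \<in> nontruncated" and k: "0 < k" and f: "f \<in> carrier A"
  shows "cycle_sum \<alpha> k \<otimes>\<^bsub>A\<^esub> f \<ominus>\<^bsub>A\<^esub> f \<otimes>\<^bsub>A\<^esub> cycle_sum \<alpha> k \<in> coordinate_kernel"
proof -
  let ?d = "k * val \<Gamma> \<alpha>"
  have left: "(cycle_sum \<alpha> k \<otimes>\<^bsub>A\<^esub> f) (cyclic_path \<beta> j m) =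
      (if \<beta> = \<alpha> \<and> ?d \<le> m then f (cyclic_path \<alpha> j (m - ?d)) else 0)"
    if \<beta>: "\<beta> \<in> nontruncated" for \<beta> j m
  proof -
    have "(cycle_sum \<alpha> k \<otimes>\<^bsub>A\<^esub> f) (cyclic_path \<beta> j m) =
      (\<Sum>l\<le>m. if l = ?d then (if \<beta> = \<alpha> then f (cyclic_path \<beta> (j + ?d) (m - ?d)) else 0) else 0)"
      unfolding mult_cyclic_path[OF \<beta>]
      by (rule sum.cong) (simp_all add: cycle_sum_cyclic_path[OF k \<alpha>])
    moreover have "cyclic_path \<alpha> (j + ?d) (m - ?d) = cyclic_path \<alpha> j (m - ?d)"
      by (rule cyclic_path_cong) simp
    ultimately show ?thesis by auto
  qed
  have right: "(f \<otimes>\<^bsub>A\<^esub> cycle_sum \<alpha> k) (cyclic_path \<beta> j m) =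
      (if \<beta> = \<alpha> \<and> ?d \<le> m then f (cyclic_path \<alpha> j (m - ?d)) else 0)"
    if \<beta>: "\<beta> \<in> nontruncated" for \<beta> j m
  proof -
    have "(f \<otimes>\<^bsub>A\<^esub> cycle_sum \<alpha> k) (cyclic_path \<beta> j m) =
      (\<Sum>l\<le>m. if l = m - ?d then
         (if \<beta> = \<alpha> \<and> ?d \<le> m then f (cyclic_path \<beta> j (m - ?d)) else 0) else 0)"
      unfolding mult_cyclic_path[OF \<beta>]
    proof (rule sum.cong[OF refl])
      fix l assume "l \<in> {..m}"
      then have "m - l = ?d \<longleftrightarrow> l = m - ?d \<and> ?d \<le> m" by auto
      then show "f (cyclic_path \<beta> j l) * cycle_sum \<alpha> k (cyclic_path \<beta> (j + l) (m - l)) =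
        (if l = m - ?d then (if \<beta> = \<alpha> \<and> ?d \<le> m then f (cyclic_path \<beta> j (m - ?d)) else 0) else 0)"
        by (auto simp: cycle_sum_cyclic_path[OF k \<alpha>])
    qed
    then show ?thesis by auto
  qed
  show ?thesis
  proof (rule commutator_in_kernelI[OF cycle_sum_closed[OF \<alpha>] f])
    show "socle_coeff V (cycle_sum \<alpha> k \<otimes>\<^bsub>A\<^esub> f) = socle_coeff V (f \<otimes>\<^bsub>A\<^esub> cycle_sum \<alpha> k)" for V
      unfolding socle_coeff_def maximal_path_def
      using arrow_source_nontruncated by (intro sum.cong refl) (simp add: left right arrows_from_iff)
  qed (simp add: left right)
qed

lemma arc_snd_less: "a \<in> arcs Q \<Longrightarrow> snd a < val \<Gamma> (fst a)"
  by (auto simp: arcs_Q)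

text \<open>
  Only the coefficient of the other factor at the trivial path contributes to either product.
\<close>

lemma maximal_path_central:
  assumes a: "a \<in> arcs Q" and f: "f \<in> carrier A"
  shows "path_elem (maximal_path a) \<otimes>\<^bsub>A\<^esub> f \<ominus>\<^bsub>A\<^esub> f \<otimes>\<^bsub>A\<^esub> path_elem (maximal_path a)
    \<in> coordinate_kernel"
proof (rule commutator_in_kernelI[OF path_elem_closed[OF maximal_path_in_paths[OF a]] f])
  have \<alpha>: "fst a \<in> nontruncated" using a by (rule arrow_source_nontruncated)
  have d: "0 < full_length (fst a)" using full_length_gt_1[OF \<alpha>] by simp
  fix \<beta> j m assume "\<beta> \<in> nontruncated" "m < full_length \<beta>"
  then show "(path_elem (maximal_path a) \<otimes>\<^bsub>A\<^esub> f) (cyclic_path \<beta> j m) =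
      (f \<otimes>\<^bsub>A\<^esub> path_elem (maximal_path a)) (cyclic_path \<beta> j m)"
    unfolding maximal_path_def
    by (auto simp: path_elem_mult_cyclic_path mult_path_elem_cyclic_path d)
next
  have \<alpha>: "fst a \<in> nontruncated" using a by (rule arrow_source_nontruncated)
  have d: "0 < full_length (fst a)" using full_length_gt_1[OF \<alpha>] by simp
  fix V
  have "(path_elem (maximal_path a) \<otimes>\<^bsub>A\<^esub> f) (maximal_path b) =
      (f \<otimes>\<^bsub>A\<^esub> path_elem (maximal_path a)) (maximal_path b)" if b: "b \<in> arrows_from V" for b
  proof -
    have \<beta>: "fst b \<in> nontruncated" using b arrow_source_nontruncated by (simp add: arrows_from_iff)
    have "cyclic_path (fst a) (snd a + full_length (fst a)) 0 = cyclic_path (fst a) (snd b) 0"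
      if "snd a mod val \<Gamma> (fst a) = snd b mod val \<Gamma> (fst a)"
      using that by (intro cyclic_path_cong) (simp add: full_length_def)
    then show ?thesis
      unfolding maximal_path_def
      by (auto simp: path_elem_mult_cyclic_path[OF \<beta> d] mult_path_elem_cyclic_path[OF \<beta> d])
  qed
  then show "socle_coeff V (path_elem (maximal_path a) \<otimes>\<^bsub>A\<^esub> f) =
      socle_coeff V (f \<otimes>\<^bsub>A\<^esub> path_elem (maximal_path a))"
    unfolding socle_coeff_def by (rule sum.cong[OF refl])
qed

text \<open>
  The path that completes the arrow \<open>a\<close> to a maximal path: it starts where \<open>a\<close> ends.
\<close>

definition co_loop :: "'v \<times> nat \<Rightarrow> ('p, 'v \<times> nat) path" where
  "co_loop a = cyclic_path (fst a) (Suc (snd a)) (full_length (fst a) - 1)"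

lemma co_loop_in_paths: "a \<in> arcs Q \<Longrightarrow> co_loop a \<in> quiver_paths Q"
  using cyclic_path_in_paths arrow_source_nontruncated by (simp add: co_loop_def)

lemma Suc_mod_cancel:
  "x < n \<Longrightarrow> y < n \<Longrightarrow> Suc x mod n = Suc y mod n \<longleftrightarrow> x = y" for x y n :: nat
  by (auto simp: mod_Suc split: if_splits)

lemma loop_iff:
  "a \<in> quiver_loops Q \<longleftrightarrow> a \<in> arcs Q \<and> stop (fst a) (snd a) = stop (fst a) (Suc (snd a))"
  by (auto simp: quiver_loops_def tail_Q head_Q)

text \<open>
  Apart from trivial paths, only \<open>a\<close> itself has nonzero products with this path in the algebra, and
  because \<open>a\<close> is a loop both products are maximal paths that start at the same polygon; they may
  be different paths, but they have the same coordinates.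
\<close>

lemma co_loop_central:
  assumes loop: "a \<in> quiver_loops Q" and f: "f \<in> carrier A"
  shows "path_elem (co_loop a) \<otimes>\<^bsub>A\<^esub> f \<ominus>\<^bsub>A\<^esub> f \<otimes>\<^bsub>A\<^esub> path_elem (co_loop a) \<in> coordinate_kernel"
proof -
  define \<alpha> i where "\<alpha> = fst a" and "i = snd a"
  define d where "d = full_length \<alpha> - 1"
  have a: "a \<in> arcs Q" and stops: "stop \<alpha> i = stop \<alpha> (Suc i)"
    using loop by (auto simp: loop_iff \<alpha>_def i_def)
  have \<alpha>: "\<alpha> \<in> nontruncated" and i: "i < val \<Gamma> \<alpha>"
    using a arrow_source_nontruncated arc_snd_less by (auto simp: \<alpha>_def i_def)
  have d: "0 < d" and d_Suc: "full_length \<alpha> = Suc d" using full_length_gt_1[OF \<alpha>] by (auto simp: d_def)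
  have co: "co_loop a = cyclic_path \<alpha> (Suc i) d" by (simp add: co_loop_def d_def \<alpha>_def i_def)
  have wrap: "cyclic_path \<alpha> (Suc i + d) m = cyclic_path \<alpha> i m" for m
  proof (rule cyclic_path_cong)
    have "Suc i + d = i + val \<Gamma> \<alpha> * bc_mu \<Gamma> \<alpha>" using d_Suc by (simp add: full_length_def)
    then show "(Suc i + d) mod val \<Gamma> \<alpha> = i mod val \<Gamma> \<alpha>" by (simp only: mod_mult_self2)
  qed
  show ?thesis
  proof (rule commutator_in_kernelI[OF path_elem_closed[OF co_loop_in_paths[OF a]] f])
    fix \<beta> j m assume \<beta>: "\<beta> \<in> nontruncated" and m: "m < full_length \<beta>"
    have "cyclic_path \<alpha> i 0 = cyclic_path \<alpha> j 0" if "Suc i mod val \<Gamma> \<alpha> = j mod val \<Gamma> \<alpha>"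
      using stop_cong[OF that] by (simp add: cyclic_path_0 stops)
    then show "(path_elem (co_loop a) \<otimes>\<^bsub>A\<^esub> f) (cyclic_path \<beta> j m) =
        (f \<otimes>\<^bsub>A\<^esub> path_elem (co_loop a)) (cyclic_path \<beta> j m)"
      unfolding co path_elem_mult_cyclic_path[OF \<beta> d] mult_path_elem_cyclic_path[OF \<beta> d]
      using m d_Suc by (cases "\<beta> = \<alpha> \<and> d \<le> m") (auto simp: wrap simp del: add_Suc)
  next
    fix V
    let ?x = "f (cyclic_path \<alpha> i 1)"
    have b: "b = (\<alpha>, j) \<longleftrightarrow> fst b = \<alpha> \<and> snd b = j" for b :: "'v \<times> nat" and j by auto
    have s: "(\<alpha>, Suc i mod val \<Gamma> \<alpha>) \<in> arcs Q" by (rule mod_arc[OF \<alpha>])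
    have "(path_elem (co_loop a) \<otimes>\<^bsub>A\<^esub> f) (maximal_path b) =
        (if b = (\<alpha>, Suc i mod val \<Gamma> \<alpha>) then ?x else 0)" if "b \<in> arrows_from V" for b
      unfolding maximal_path_def co
      using that arrow_source_nontruncated[of b] arc_snd_less[of b] d_Suc
      by (subst path_elem_mult_cyclic_path[OF _ d]) (auto simp: arrows_from_iff wrap b simp del: add_Suc)
    then have "socle_coeff V (path_elem (co_loop a) \<otimes>\<^bsub>A\<^esub> f) =
        (\<Sum>b\<in>arrows_from V. if b = (\<alpha>, Suc i mod val \<Gamma> \<alpha>) then ?x else 0)"
      unfolding socle_coeff_def by (intro sum.cong refl)
    also have "\<dots> = (if (\<alpha>, Suc i mod val \<Gamma> \<alpha>) \<in> arrows_from V then ?x else 0)"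
      using finite_arrows_from by simp
    also have "(\<alpha>, Suc i mod val \<Gamma> \<alpha>) \<in> arrows_from V \<longleftrightarrow> a \<in> arrows_from V"
      using s a stops by (simp add: arrows_from_iff stop_mod) (simp add: \<alpha>_def i_def)
    also have "(if a \<in> arrows_from V then ?x else 0) = (\<Sum>b\<in>arrows_from V. if b = a then ?x else 0)"
      using finite_arrows_from by simp
    also have "\<dots> = socle_coeff V (f \<otimes>\<^bsub>A\<^esub> path_elem (co_loop a))"
      unfolding socle_coeff_def
    proof (rule sum.cong[OF refl])
      fix b assume "b \<in> arrows_from V"
      then have b': "fst b \<in> nontruncated" "snd b < val \<Gamma> (fst b)"
        using arrow_source_nontruncated[of b] arc_snd_less[of b] by (auto simp: arrows_from_iff)
      have "Suc i mod val \<Gamma> \<alpha> = Suc (snd b) mod val \<Gamma> \<alpha> \<longleftrightarrow> snd b = i" if "fst b = \<alpha>"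
        using Suc_mod_cancel[OF i, of "snd b"] b' that by auto
      moreover have "b = a \<longleftrightarrow> fst b = \<alpha> \<and> snd b = i" by (auto simp: \<alpha>_def i_def prod_eq_iff)
      ultimately show "(if b = a then ?x else 0) = (f \<otimes>\<^bsub>A\<^esub> path_elem (co_loop a)) (maximal_path b)"
        unfolding maximal_path_def co mult_path_elem_cyclic_path[OF b'(1) d]
        using d_Suc by auto
    qed
    finally show "socle_coeff V (path_elem (co_loop a) \<otimes>\<^bsub>A\<^esub> f) =
        socle_coeff V (f \<otimes>\<^bsub>A\<^esub> path_elem (co_loop a))" .
  qed
qed

end

section \<open>A dual basis of the center\<close>

datatype ('v, 'p) center_index = Unit | Cycle 'v nat | Socle 'p | Loop "'v \<times> nat"

context brauer_configuration
begin

text \<open>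
  Two different polygons that share a vertex \<open>\<alpha>\<close> force \<open>val \<alpha> > 1\<close>. So \<open>\<alpha>\<close> is nontruncated and
  both polygons occur in its successor sequence, along which \<open>g\<close> is constant.
\<close>

lemma stop_invariant_imp_constant:
  assumes conn: "bc_connected \<Gamma>"
    and inv: "\<And>\<alpha> i. \<alpha> \<in> nontruncated \<Longrightarrow> g (stop \<alpha> i) = g (stop \<alpha> (Suc i))"
    and V: "V \<in> bc_polys \<Gamma>" "W \<in> bc_polys \<Gamma>"
  shows "g V = g W"
proof (rule ccontr)
  assume ne: "g V \<noteq> g W"
  define X where "X = {U \<in> bc_polys \<Gamma>. g U = g V}"
  define Y where "Y = {U \<in> bc_polys \<Gamma>. g U \<noteq> g V}"
  have "X \<noteq> {}" "Y \<noteq> {}" "X \<inter> Y = {}" "X \<union> Y = bc_polys \<Gamma>"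
    using V ne by (auto simp: X_def Y_def)
  then obtain \<alpha> U U' where U: "U \<in> X" "U' \<in> Y" "\<alpha> \<in># bc_mset \<Gamma> U" "\<alpha> \<in># bc_mset \<Gamma> U'"
    using conn unfolding bc_connected_def by meson
  then have UU': "U \<in> bc_polys \<Gamma>" "U' \<in> bc_polys \<Gamma>" "g U \<noteq> g U'" by (auto simp: X_def Y_def)
  then have "U \<noteq> U'" by auto
  have \<alpha>: "\<alpha> \<in> bc_verts \<Gamma>" using polys_verts[OF UU'(1)] U(3) by auto
  have "(\<Sum>P\<in>{U, U'}. occ \<Gamma> \<alpha> P) \<le> val \<Gamma> \<alpha>"
    unfolding val_def by (rule sum_mono2) (use finite_polys UU' in auto)
  moreover have "occ \<Gamma> \<alpha> U > 0" "occ \<Gamma> \<alpha> U' > 0" using U by (auto simp: occ_def)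
  ultimately have "val \<Gamma> \<alpha> > 1" using \<open>U \<noteq> U'\<close> by simp
  then have n: "\<alpha> \<in> nontruncated" using \<alpha> by (auto simp: truncated_def)
  have const: "g (stop \<alpha> i) = g (stop \<alpha> 0)" for i
    by (induction i) (simp_all add: inv[OF n, symmetric])
  have "\<exists>i. stop \<alpha> i = P" if "P \<in> set (bc_succ \<Gamma> \<alpha>)" for P
    using that by (metis in_set_conv_nth length_succ[OF n] mod_less stop_def)
  moreover have "U \<in> set (bc_succ \<Gamma> \<alpha>)" "U' \<in> set (bc_succ \<Gamma> \<alpha>)"
    using U UU' by (auto simp: set_succ[OF n])
  ultimately show False using const UU'(3) by metis
qed

text \<open>
  Any polygon would do: a central element has the same coefficient at all trivial paths.
\<close>

definition base_polygon :: 'p where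
  "base_polygon = (SOME V. V \<in> bc_polys \<Gamma>)"

definition base_arrow :: "'p \<Rightarrow> 'v \<times> nat" where
  "base_arrow V = (SOME a. a \<in> arrows_from V)"

text \<open>
  A loop that belongs to a vertex of valency one is left out: the path that completes it to a
  maximal path is the \<open>(\<mu> - 1)\<close>-st power of the loop, which is already counted by \<open>Cycle\<close>.
\<close>

definition center_indices :: "('v, 'p) center_index set" where
  "center_indices = {Unit} \<union> case_prod Cycle ` (SIGMA \<alpha>:bc_verts \<Gamma>. {1..<bc_mu \<Gamma> \<alpha>}) \<union>
     Socle ` bc_polys \<Gamma> \<union> Loop ` {a \<in> quiver_loops Q. val \<Gamma> (fst a) > 1}"

fun central_elem :: "('v, 'p) center_index \<Rightarrow> ('p, 'v \<times> nat) path \<Rightarrow> 'k::field" where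
  "central_elem Unit = \<one>\<^bsub>A\<^esub>"
| "central_elem (Cycle \<alpha> k) = cycle_sum \<alpha> k"
| "central_elem (Socle V) = path_elem (maximal_path (base_arrow V))"
| "central_elem (Loop a) = path_elem (co_loop a)"

fun center_coord ::
  "('v, 'p) center_index \<Rightarrow> (('p, 'v \<times> nat) path \<Rightarrow> 'k::field) \<Rightarrow> 'k" where
  "center_coord Unit f = f (base_polygon, [], base_polygon)"
| "center_coord (Cycle \<alpha> k) f = f (cyclic_path \<alpha> 0 (k * val \<Gamma> \<alpha>))"
| "center_coord (Socle V) f = socle_coeff V f"
| "center_coord (Loop a) f = f (co_loop a)"

lemma base_arrow: "V \<in> bc_polys \<Gamma> \<Longrightarrow> base_arrow V \<in> arrows_from V"
  unfolding base_arrow_def using some_in_eq arrows_from_nonempty by blast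

lemma base_arrow_arc:
  assumes "V \<in> bc_polys \<Gamma>"
  shows "base_arrow V \<in> arcs Q" "stop (fst (base_arrow V)) (snd (base_arrow V)) = V"
  using base_arrow[OF assms] by (auto simp: arrows_from_iff)

lemma trivial_path_is_cyclic_path:
  assumes "V \<in> bc_polys \<Gamma>"
  obtains \<alpha> i where "\<alpha> \<in> nontruncated" "(V, [], V) = cyclic_path \<alpha> i 0"
proof (rule that)
  show "fst (base_arrow V) \<in> nontruncated"
    by (rule arrow_source_nontruncated[OF base_arrow_arc(1)[OF assms]])
  show "(V, [], V) = cyclic_path (fst (base_arrow V)) (snd (base_arrow V)) 0"
    by (simp add: cyclic_path_0 base_arrow_arc(2)[OF assms])
qed

lemma Cycle_index:
  assumes "Cycle \<alpha> k \<in> center_indices"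
  shows "\<alpha> \<in> nontruncated" "0 < k" "k < bc_mu \<Gamma> \<alpha>" "0 < k * val \<Gamma> \<alpha>" "k * val \<Gamma> \<alpha> < full_length \<alpha>"
proof -
  have \<alpha>: "\<alpha> \<in> bc_verts \<Gamma>" and k: "0 < k" "k < bc_mu \<Gamma> \<alpha>"
    using assms by (auto simp: center_indices_def)
  have "bc_mu \<Gamma> \<alpha> \<noteq> 1" using k by simp
  then show "\<alpha> \<in> nontruncated" using \<alpha> by (auto simp: truncated_def)
  show "0 < k" "k < bc_mu \<Gamma> \<alpha>" by (rule k)+
  show "0 < k * val \<Gamma> \<alpha>" "k * val \<Gamma> \<alpha> < full_length \<alpha>"
    using k val_pos[OF \<alpha>] by (auto simp: full_length_def)
qed

lemma Socle_index: "Socle V \<in> center_indices \<longleftrightarrow> V \<in> bc_polys \<Gamma>"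
  by (auto simp: center_indices_def)

lemma Loop_index: "Loop a \<in> center_indices \<longleftrightarrow> a \<in> quiver_loops Q \<and> val \<Gamma> (fst a) > 1"
  by (auto simp: center_indices_def)

text \<open>
  The path that completes a loop to a maximal path is never a power of a special cycle if the
  valency is greater than one. This separates the indices \<open>Loop\<close> from the indices \<open>Cycle\<close>.
\<close>

lemma not_val_dvd_full_length_minus_1:
  assumes "\<alpha> \<in> nontruncated" "val \<Gamma> \<alpha> > 1"
  shows "full_length \<alpha> - 1 \<noteq> k * val \<Gamma> \<alpha>"
proof
  assume "full_length \<alpha> - 1 = k * val \<Gamma> \<alpha>"
  moreover have "val \<Gamma> \<alpha> dvd full_length \<alpha>" by (simp add: full_length_def)
  moreover have "full_length \<alpha> = Suc (full_length \<alpha> - 1)" using full_length_gt_1[OF assms(1)] by simp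
  ultimately have "val \<Gamma> \<alpha> dvd Suc (k * val \<Gamma> \<alpha>)" by metis
  then have "val \<Gamma> \<alpha> dvd 1" by (metis Suc_eq_plus1 dvd_add_right_iff dvd_triv_right)
  with assms(2) show False by simp
qed

lemma finite_center_indices: "finite center_indices"
proof -
  have "quiver_loops Q \<subseteq> arcs Q" by (auto simp: quiver_loops_def)
  then have "finite (quiver_loops Q)" using finite_arcs_Q by (rule finite_subset)
  then show ?thesis
    using finite_verts finite_polys by (simp add: center_indices_def)
qed

lemma central_elem_closed:
  assumes "j \<in> center_indices" shows "central_elem j \<in> carrier A"
proof (cases j)
  case Unit
  then show ?thesis by (simp add: path_algebra_one_closed)
next
  case (Cycle \<alpha> k)
  then show ?thesis using assms Cycle_index(1)[of \<alpha> k] by (simp add: cycle_sum_closed)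
next
  case (Socle V)
  then have "V \<in> bc_polys \<Gamma>" using assms by (simp add: Socle_index)
  then show ?thesis
    using Socle by (simp add: path_elem_closed maximal_path_in_paths base_arrow_arc)
next
  case (Loop a)
  then have "a \<in> arcs Q" using assms by (simp add: Loop_index loop_iff)
  then show ?thesis using Loop by (simp add: path_elem_closed co_loop_in_paths)
qed

lemma central_elem_central:
  assumes j: "j \<in> center_indices" and x: "x \<in> carrier A"
  shows "central_elem j \<otimes>\<^bsub>A\<^esub> x \<ominus>\<^bsub>A\<^esub> x \<otimes>\<^bsub>A\<^esub> central_elem j \<in> coordinate_kernel"
proof (cases j)
  case Unit
  have "x \<ominus>\<^bsub>A\<^esub> x = \<zero>\<^bsub>A\<^esub>" using x by (simp add: a_minus_def Lambda.A.r_neg)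
  then show ?thesis
    using additive_subgroup.zero_closed[OF ideal.axioms(1)[OF ideal_coordinate_kernel]]
    by (simp add: Unit path_algebra_l_one[OF x] path_algebra_r_one[OF x])
next
  case (Cycle \<alpha> k)
  then show ?thesis using cycle_sum_central[OF _ _ x] j Cycle_index by simp
next
  case (Socle V)
  then have "V \<in> bc_polys \<Gamma>" using j by (simp add: Socle_index)
  then show ?thesis using Socle maximal_path_central[OF base_arrow_arc(1) x] by simp
next
  case (Loop a)
  then have "a \<in> quiver_loops Q" using j by (simp add: Loop_index)
  then show ?thesis using Loop co_loop_central[OF _ x] by simp
qed

lemma center_coord_add: "center_coord j (f \<oplus>\<^bsub>A\<^esub> g) = center_coord j f + center_coord j g"
  by (cases j) (simp_all add: socle_coeff_add, simp_all add: path_algebra_simps)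

lemma center_coord_smult: "center_coord j (c \<odot>\<^bsub>A\<^esub> f) = c * center_coord j f"
  by (cases j) (simp_all add: socle_coeff_smult, simp_all add: path_algebra_simps)

lemma base_polygon: "bc_connected \<Gamma> \<Longrightarrow> base_polygon \<in> bc_polys \<Gamma>"
  unfolding base_polygon_def bc_connected_def using some_in_eq by blast

lemma center_coord_vanishes:
  assumes conn: "bc_connected \<Gamma>" and j: "j \<in> center_indices" and f: "f \<in> coordinate_kernel"
  shows "center_coord j f = 0"
proof (cases j)
  case Unit
  obtain \<alpha> i where "\<alpha> \<in> nontruncated" "(base_polygon, [], base_polygon) = cyclic_path \<alpha> i 0"
    using trivial_path_is_cyclic_path[OF base_polygon[OF conn]] .
  then show ?thesis
    using Unit coordinate_kernelD(2)[OF f] full_length_gt_1[of \<alpha>] by simp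
next
  case (Cycle \<alpha> k)
  then show ?thesis
    using coordinate_kernelD(2)[OF f] j Cycle_index by simp
next
  case (Socle V)
  then show ?thesis using coordinate_kernelD(3)[OF f] j by (simp add: Socle_index)
next
  case (Loop a)
  then have "fst a \<in> nontruncated"
    using j arrow_source_nontruncated by (simp add: Loop_index loop_iff)
  then show ?thesis
    using Loop coordinate_kernelD(2)[OF f] full_length_gt_1[of "fst a"] by (simp add: co_loop_def)
qed

lemma path_elem_trivial: "0 < m \<Longrightarrow> path_elem (cyclic_path \<alpha> i m) (V, [], V) = 0"
  by (auto simp: path_elem_def cyclic_path_def dest: arg_cong[of _ _ length])

lemma one_cyclic_path: "0 < m \<Longrightarrow> \<one>\<^bsub>A\<^esub> (cyclic_path \<alpha> i m) = 0"
  by (simp add: path_algebra_simps cyclic_path_def)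

lemma Loop_index_facts:
  assumes "Loop a \<in> center_indices"
  shows "fst a \<in> nontruncated" "snd a < val \<Gamma> (fst a)" "val \<Gamma> (fst a) > 1"
    "full_length (fst a) > 1" "full_length (fst a) - 1 \<noteq> k * val \<Gamma> (fst a)"
proof -
  have a: "a \<in> arcs Q" "val \<Gamma> (fst a) > 1" using assms by (auto simp: Loop_index loop_iff)
  show n: "fst a \<in> nontruncated" by (rule arrow_source_nontruncated[OF a(1)])
  show "snd a < val \<Gamma> (fst a)" by (rule arc_snd_less[OF a(1)])
  show "val \<Gamma> (fst a) > 1" by (rule a(2))
  show "full_length (fst a) > 1" by (rule full_length_gt_1[OF n])
  show "full_length (fst a) - 1 \<noteq> k * val \<Gamma> (fst a)"
    by (rule not_val_dvd_full_length_minus_1[OF n a(2)])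
qed

lemma center_coord_dual:
  assumes conn: "bc_connected \<Gamma>" and i: "i \<in> center_indices" and j: "j \<in> center_indices"
  shows "center_coord j (central_elem i) = (if i = j then 1 else 0)"
proof (cases i)
  case Unit
  show ?thesis
  proof (cases j)
    case Unit': Unit
    show ?thesis using base_polygon[OF conn] by (simp add: Unit Unit' path_algebra_simps verts_Q)
  next
    case (Cycle \<beta> l)
    then show ?thesis using Cycle_index(4)[of \<beta> l] j by (simp add: Unit one_cyclic_path)
  next
    case (Socle W)
    have "\<one>\<^bsub>A\<^esub> (maximal_path b) = (0::'a)" if "b \<in> arrows_from W" for b
    proof -
      have "fst b \<in> nontruncated" using that arrow_source_nontruncated by (simp add: arrows_from_iff)
      from full_length_gt_1[OF this] show ?thesis by (simp add: maximal_path_def one_cyclic_path)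
    qed
    then show ?thesis by (simp add: Unit Socle socle_coeff_def)
  next
    case (Loop b)
    then show ?thesis
      using Loop_index_facts(4)[of b] j by (simp add: Unit co_loop_def one_cyclic_path)
  qed
next
  case (Cycle \<alpha> k)
  note \<alpha> = Cycle_index[OF i[unfolded Cycle]]
  note at_path = cycle_sum_cyclic_path[OF \<alpha>(2,1)]
  show ?thesis
  proof (cases j)
    case Unit
    obtain \<beta> l where "\<beta> \<in> nontruncated" "(base_polygon, [], base_polygon) = cyclic_path \<beta> l 0"
      using trivial_path_is_cyclic_path[OF base_polygon[OF conn]] .
    then show ?thesis using \<alpha>(4) by (simp add: Cycle Unit at_path)
  next
    case Cycle': (Cycle \<beta> l)
    then show ?thesis using \<alpha>(4) by (auto simp: Cycle Cycle' at_path)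
  next
    case (Socle W)
    have "cycle_sum \<alpha> k (maximal_path b) = (0::'a)" if "b \<in> arrows_from W" for b
      using \<alpha>(5) by (simp add: maximal_path_def at_path)
    then show ?thesis by (simp add: Cycle Socle socle_coeff_def)
  next
    case (Loop b)
    then show ?thesis
      using Loop_index_facts(5)[of b k] j by (auto simp: Cycle co_loop_def at_path)
  qed
next
  case (Socle V)
  then have V: "V \<in> bc_polys \<Gamma>" using i by (simp add: Socle_index)
  define a where "a = base_arrow V"
  have a: "a \<in> arcs Q" "stop (fst a) (snd a) = V" using base_arrow_arc[OF V] by (auto simp: a_def)
  have d: "full_length (fst a) > 1" by (rule full_length_gt_1[OF arrow_source_nontruncated[OF a(1)]])
  then have d0: "0 < full_length (fst a)" by simp
  show ?thesis
  proof (cases j)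
    case Unit
    then show ?thesis using d0 by (simp add: Socle a_def[symmetric] maximal_path_def path_elem_trivial)
  next
    case (Cycle \<beta> l)
    then show ?thesis
      using Cycle_index(5)[of \<beta> l] j
      by (auto simp: Socle a_def[symmetric] maximal_path_def path_elem_cyclic_path[OF d0])
  next
    case Socle': (Socle W)
    then show ?thesis by (simp add: Socle a_def[symmetric] socle_coeff_maximal_path[OF a(1)] a(2))
  next
    case (Loop b)
    then show ?thesis
      using d by (auto simp: Socle a_def[symmetric] maximal_path_def co_loop_def path_elem_cyclic_path[OF d0])
  qed
next
  case (Loop a)
  note a = Loop_index_facts[OF i[unfolded Loop]]
  have d0: "0 < full_length (fst a) - Suc 0" using a(4) by simp
  show ?thesis
  proof (cases j)
    case Unit
    then show ?thesis using d0 by (simp add: Loop co_loop_def path_elem_trivial)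
  next
    case (Cycle \<beta> l)
    then show ?thesis
      using a(5)[of l] by (auto simp: Loop co_loop_def path_elem_cyclic_path[OF d0])
  next
    case (Socle W)
    have "path_elem (co_loop a) (maximal_path b) = (0::'a)" for b
      using a(4) by (auto simp: co_loop_def maximal_path_def path_elem_cyclic_path[OF d0])
    then show ?thesis by (simp add: Loop Socle socle_coeff_def)
  next
    case Loop': (Loop b)
    note b = Loop_index_facts[OF j[unfolded Loop']]
    have "a = b" if "fst b = fst a" "Suc (snd a) mod val \<Gamma> (fst a) = Suc (snd b) mod val \<Gamma> (fst a)"
      using that a(2) b(2) Suc_mod_cancel[of "snd a" "val \<Gamma> (fst a)" "snd b"] by (simp add: prod_eq_iff)
    then show ?thesis
      by (auto simp: Loop Loop' co_loop_def path_elem_cyclic_path[OF d0])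
  qed
qed

text \<open>
  Let \<open>p\<close> be a path along the successor sequence of \<open>\<alpha>\<close> and \<open>a\<close> the arrow that continues it. If
  \<open>p a\<close> is shorter than a maximal path, the coefficients of \<open>z a\<close> and \<open>a z\<close> at \<open>p a\<close> have to agree.
  So the coefficient of \<open>z\<close> at \<open>p\<close> is zero unless the length of \<open>p\<close> is a multiple of the valency,
  and then it does not change if \<open>p\<close> is moved by one position (\<open>shift\<close>). For trivial paths and
  connected \<open>\<Gamma>\<close> this gives a single value, for powers of special cycles one value for each exponent.
  The only other paths have one arrow less than a maximal path. They complete some arrow to a
  maximal path; if that arrow is a loop, their coefficient is a selected coordinate, and otherwise
  they are not closed and the trivial path at their start shows that their coefficient is zero.
\<close>

lemma center_coord_separating:
  assumes conn: "bc_connected \<Gamma>" and z: "z \<in> carrier A"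
    and comm: "\<And>x. x \<in> carrier A \<Longrightarrow> z \<otimes>\<^bsub>A\<^esub> x \<ominus>\<^bsub>A\<^esub> x \<otimes>\<^bsub>A\<^esub> z \<in> coordinate_kernel"
    and zero: "\<And>j. j \<in> center_indices \<Longrightarrow> center_coord j z = 0"
  shows "z \<in> coordinate_kernel"
proof -
  have commutes: "(z \<otimes>\<^bsub>A\<^esub> path_elem p) (cyclic_path \<alpha> i m) = (path_elem p \<otimes>\<^bsub>A\<^esub> z) (cyclic_path \<alpha> i m)"
    if "p \<in> quiver_paths Q" "\<alpha> \<in> nontruncated" "m < full_length \<alpha>" for p \<alpha> i m
    using comm[OF path_elem_closed[OF that(1)]] that path_elem_closed[OF that(1), where 'b = 'a] z
    by (simp add: diff_in_kernel_iff path_algebra_mult_closed)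
  have shift: "z (cyclic_path \<alpha> i m) =
      (if i mod val \<Gamma> \<alpha> = (i + m) mod val \<Gamma> \<alpha> then z (cyclic_path \<alpha> (Suc i) m) else 0)"
    if \<alpha>: "\<alpha> \<in> nontruncated" and m: "Suc m < full_length \<alpha>" for \<alpha> i m
  proof -
    have "(z \<otimes>\<^bsub>A\<^esub> path_elem (cyclic_path \<alpha> (i + m) 1)) (cyclic_path \<alpha> i (Suc m)) =
        (path_elem (cyclic_path \<alpha> (i + m) 1) \<otimes>\<^bsub>A\<^esub> z) (cyclic_path \<alpha> i (Suc m))"
      by (rule commutes[OF cyclic_path_in_paths[OF \<alpha>] \<alpha> m])
    moreover have "cyclic_path \<alpha> (Suc (i + m)) m = cyclic_path \<alpha> (Suc i) m"
      if "(i + m) mod val \<Gamma> \<alpha> = i mod val \<Gamma> \<alpha>"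
      by (rule cyclic_path_cong) (metis mod_Suc_eq that)
    ultimately show ?thesis
      by (auto simp: path_elem_mult_cyclic_path[OF \<alpha>] mult_path_elem_cyclic_path[OF \<alpha>] split: if_splits)
  qed
  have trivial: "z (V, [], V) = 0" if V: "V \<in> bc_polys \<Gamma>" for V
  proof -
    have "z (stop \<alpha> i, [], stop \<alpha> i) = z (stop \<alpha> (Suc i), [], stop \<alpha> (Suc i))"
      if "\<alpha> \<in> nontruncated" for \<alpha> i
      using shift[OF that, of 0 i] full_length_gt_1[OF that] by (simp add: cyclic_path_0)
    then have "z (V, [], V) = z (base_polygon, [], base_polygon)"
      by (rule stop_invariant_imp_constant[OF conn, where g = "\<lambda>V. z (V, [], V)"])
        (auto simp: V base_polygon[OF conn])
    also have "\<dots> = 0" using zero[of Unit] by (simp add: center_indices_def)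
    finally show ?thesis .
  qed
  have nonclosed: "z (cyclic_path \<alpha> i m) = 0"
    if \<alpha>: "\<alpha> \<in> nontruncated" and m: "m < full_length \<alpha>" and ne: "stop \<alpha> i \<noteq> stop \<alpha> (i + m)" for \<alpha> i m
  proof -
    have "(z \<otimes>\<^bsub>A\<^esub> path_elem (stop \<alpha> i, [], stop \<alpha> i)) (cyclic_path \<alpha> i m) =
        (path_elem (stop \<alpha> i, [], stop \<alpha> i) \<otimes>\<^bsub>A\<^esub> z) (cyclic_path \<alpha> i m)"
      by (rule commutes[OF trivial_path_in_paths[OF stop_in_polys[OF \<alpha>]] \<alpha> m])
    then show ?thesis
      using ne by (simp add: trivial_mult_cyclic_path[OF \<alpha>] mult_trivial_cyclic_path[OF \<alpha>])
  qed
  have powers: "z (cyclic_path \<alpha> i (k * val \<Gamma> \<alpha>)) = 0"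
    if \<alpha>: "\<alpha> \<in> nontruncated" and k: "0 < k" "k < bc_mu \<Gamma> \<alpha>" for \<alpha> i k
  proof -
    have step: "z (cyclic_path \<alpha> i (k * val \<Gamma> \<alpha>)) = z (cyclic_path \<alpha> (Suc i) (k * val \<Gamma> \<alpha>))" for i
    proof (cases "val \<Gamma> \<alpha> = 1")
      case True
      then have "cyclic_path \<alpha> i (k * val \<Gamma> \<alpha>) = cyclic_path \<alpha> (Suc i) (k * val \<Gamma> \<alpha>)"
        by (intro cyclic_path_cong) simp
      then show ?thesis by simp
    next
      case False
      then have "1 < val \<Gamma> \<alpha>" using val_pos[of \<alpha>] \<alpha> by simp
      moreover have "Suc k * val \<Gamma> \<alpha> \<le> full_length \<alpha>"
        unfolding full_length_def using k(2) by (subst mult.commute) (intro mult_le_mono, auto)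
      ultimately have "Suc (k * val \<Gamma> \<alpha>) < full_length \<alpha>" by simp
      then show ?thesis using shift[OF \<alpha>, of "k * val \<Gamma> \<alpha>" i] by simp
    qed
    have "z (cyclic_path \<alpha> i (k * val \<Gamma> \<alpha>)) = z (cyclic_path \<alpha> 0 (k * val \<Gamma> \<alpha>))"
      by (induction i) (simp_all add: step[symmetric])
    also have "\<dots> = 0"
    proof -
      have "Cycle \<alpha> k \<in> center_indices" using \<alpha> k by (force simp: center_indices_def)
      from zero[OF this] show ?thesis by simp
    qed
    finally show ?thesis .
  qed
  have co_loops: "z (cyclic_path \<alpha> i (full_length \<alpha> - 1)) = 0"
    if \<alpha>: "\<alpha> \<in> nontruncated" and n: "val \<Gamma> \<alpha> > 1" for \<alpha> i
  proof (cases "stop \<alpha> i = stop \<alpha> (i + (full_length \<alpha> - 1))")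
    case False
    then show ?thesis using nonclosed[OF \<alpha>] full_length_gt_1[OF \<alpha>] by simp
  next
    case True
    define a where "a = (\<alpha>, (i + (full_length \<alpha> - 1)) mod val \<Gamma> \<alpha>)"
    have Suc: "Suc (i + (full_length \<alpha> - 1)) = i + full_length \<alpha>"
      using full_length_gt_1[OF \<alpha>] by simp
    have "a \<in> quiver_loops Q"
      unfolding loop_iff using mod_arc[OF \<alpha>] True
      by (simp add: a_def stop_mod stop_Suc_mod) (simp add: Suc flip: One_nat_def)
    then have "z (co_loop a) = 0" using zero[of "Loop a"] n by (simp add: Loop_index a_def)
    moreover have "co_loop a = cyclic_path \<alpha> i (full_length \<alpha> - 1)"
      unfolding co_loop_def a_def fst_conv snd_conv
      by (rule cyclic_path_cong, subst mod_Suc_eq, subst Suc) (simp add: full_length_def)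
    ultimately show ?thesis by simp
  qed
  have "z (cyclic_path \<alpha> i m) = 0" if \<alpha>: "\<alpha> \<in> nontruncated" and m: "m < full_length \<alpha>" for \<alpha> i m
  proof (cases "m = 0")
    case True
    then show ?thesis using trivial[OF stop_in_polys[OF \<alpha>]] by (simp add: cyclic_path_0)
  next
    case False
    show ?thesis
    proof (cases "val \<Gamma> \<alpha> dvd m")
      case True
      then obtain k where k: "m = k * val \<Gamma> \<alpha>" by (metis dvd_def mult.commute)
      then show ?thesis using powers[OF \<alpha>, of k i] False m by (simp add: full_length_def)
    next
      case ndvd: False
      then have "val \<Gamma> \<alpha> \<noteq> 1" by auto
      then have n: "val \<Gamma> \<alpha> > 1" using val_pos[of \<alpha>] \<alpha> by simp
      show ?thesis
      proof (cases "Suc m < full_length \<alpha>")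
        case True
        have "i mod val \<Gamma> \<alpha> \<noteq> (i + m) mod val \<Gamma> \<alpha>"
          using ndvd mod_eq_dvd_iff_nat[of i "i + m" "val \<Gamma> \<alpha>"] by auto
        then show ?thesis using shift[OF \<alpha> True] by simp
      next
        case False
        then have "m = full_length \<alpha> - 1" using m by simp
        then show ?thesis using co_loops[OF \<alpha> n] by simp
      qed
    qed
  qed
  moreover have "socle_coeff V z = 0" if "V \<in> bc_polys \<Gamma>" for V
    using zero[of "Socle V"] that by (simp add: Socle_index)
  ultimately show ?thesis using z unfolding coordinate_kernel_def by blast
qed

lemma card_center_indices:
  "int (card center_indices) = 1 + (\<Sum>\<alpha>\<in>bc_verts \<Gamma>. int (bc_mu \<Gamma> \<alpha>)) + int (card (bc_polys \<Gamma>))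
    - int (card (bc_verts \<Gamma>)) + int (card (quiver_loops Q))
    - int (card {\<gamma> \<in> bc_verts \<Gamma>. val \<Gamma> \<gamma> = 1 \<and> bc_mu \<Gamma> \<gamma> > 1})"
proof -
  let ?C = "SIGMA \<alpha>:bc_verts \<Gamma>. {1..<bc_mu \<Gamma> \<alpha>}"
  let ?L = "{a \<in> quiver_loops Q. val \<Gamma> (fst a) > 1}"
  let ?S = "{\<gamma> \<in> bc_verts \<Gamma>. val \<Gamma> \<gamma> = 1 \<and> bc_mu \<Gamma> \<gamma> > 1}"
  have finL: "finite (quiver_loops Q)"
    using finite_arcs_Q by (rule rev_finite_subset) (auto simp: quiver_loops_def)
  have finC: "finite ?C" using finite_verts by simp
  let ?U = "{Unit} :: ('v, 'p) center_index set"
  let ?C' = "case_prod Cycle ` ?C :: ('v, 'p) center_index set"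
  let ?S' = "Socle ` bc_polys \<Gamma> :: ('v, 'p) center_index set"
  let ?L' = "Loop ` ?L :: ('v, 'p) center_index set"
  have fin: "finite ?U" "finite ?C'" "finite ?S'" "finite ?L'"
    using finL finC finite_polys by simp_all
  have "?U \<inter> ?C' = {}" "(?U \<union> ?C') \<inter> ?S' = {}" "(?U \<union> ?C' \<union> ?S') \<inter> ?L' = {}"
    by auto
  then have "card center_indices = card ?U + card ?C' + card ?S' + card ?L'"
    unfolding center_indices_def by (simp only: card_Un_disjoint fin finite_Un simp_thms)
  also have "\<dots> = 1 + card ?C + card (bc_polys \<Gamma>) + card ?L"
    by (simp add: card_image inj_on_def)
  finally have 1: "card center_indices = 1 + card ?C + card (bc_polys \<Gamma>) + card ?L" .
  have "card ?C = (\<Sum>\<alpha>\<in>bc_verts \<Gamma>. bc_mu \<Gamma> \<alpha> - 1)"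
    using finite_verts by simp
  then have "int (card ?C) = (\<Sum>\<alpha>\<in>bc_verts \<Gamma>. int (bc_mu \<Gamma> \<alpha>) - 1)"
    using mu_pos by (simp add: of_nat_diff Suc_leI)
  then have 2: "int (card ?C) = (\<Sum>\<alpha>\<in>bc_verts \<Gamma>. int (bc_mu \<Gamma> \<alpha>)) - int (card (bc_verts \<Gamma>))"
    by (simp add: sum_subtractf)
  \<comment> \<open>A nontruncated vertex of valency one has multiplicity greater than one and carries one loop.\<close>
  have "quiver_loops Q = ?L \<union> (\<lambda>\<gamma>. (\<gamma>, 0)) ` ?S"
  proof (intro equalityI subsetI)
    fix a assume a: "a \<in> quiver_loops Q"
    then have arc: "fst a \<in> nontruncated" "snd a < val \<Gamma> (fst a)"
      using arrow_source_nontruncated arc_snd_less by (auto simp: loop_iff)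
    show "a \<in> ?L \<union> (\<lambda>\<gamma>. (\<gamma>, 0)) ` ?S"
    proof (cases "val \<Gamma> (fst a) > 1")
      case False
      then have v: "val \<Gamma> (fst a) = 1" "a = (fst a, 0)" using arc(2) by (auto simp: prod_eq_iff)
      then have "fst a \<in> ?S" using arc(1) nontruncated_cases[OF arc(1)] by auto
      then show ?thesis using v(2) by blast
    qed (use a in simp)
  next
    fix a assume "a \<in> ?L \<union> (\<lambda>\<gamma>. (\<gamma>, 0)) ` ?S"
    then show "a \<in> quiver_loops Q"
    proof
      assume "a \<in> (\<lambda>\<gamma>. (\<gamma>, 0)) ` ?S"
      then obtain \<gamma> where \<gamma>: "a = (\<gamma>, 0)" "\<gamma> \<in> bc_verts \<Gamma>" "val \<Gamma> \<gamma> = 1" "bc_mu \<Gamma> \<gamma> > 1" by auto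
      then have "a \<in> arcs Q" by (auto simp: arcs_Q truncated_def)
      then show ?thesis using \<gamma> by (simp add: loop_iff stop_def)
    qed simp
  qed
  moreover have "?L \<inter> (\<lambda>\<gamma>. (\<gamma>, 0)) ` ?S = {}" by auto
  moreover have "finite ?S" using finite_verts by simp
  ultimately have "card (quiver_loops Q) = card ?L + card ((\<lambda>\<gamma>. (\<gamma>, 0 :: nat)) ` ?S)"
    using finL by (metis (no_types, lifting) card_Un_disjoint finite_Un)
  then have 3: "card (quiver_loops Q) = card ?L + card ?S"
    by (simp add: card_image inj_on_def)
  show ?thesis using 1 2 3 by simp
qed

end

theorem theorem4p9:
  fixes \<Gamma> :: "('v, 'p) brauer_config"
    and \<Lambda> :: "('k::field, (('p, 'v \<times> nat) path \<Rightarrow> 'k) set) module"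
  assumes "brauer_configuration \<Gamma>"
    and "bc_connected \<Gamma>"
    and "bc_reduced \<Gamma>"
    and "\<Lambda> = brauer_algebra \<Gamma>"
  shows "vectorspace.fin_dim (class_ring :: 'k ring) (center_space \<Lambda>) \<and>
    int (vectorspace.dim (class_ring :: 'k ring) (center_space \<Lambda>)) =
      1 + (\<Sum>\<alpha>\<in>bc_verts \<Gamma>. int (bc_mu \<Gamma> \<alpha>)) + int (card (bc_polys \<Gamma>)) - int (card (bc_verts \<Gamma>))
        + int (card (quiver_loops (bc_quiver \<Gamma>)))
        - int (card {\<gamma> \<in> bc_verts \<Gamma>. val \<Gamma> \<gamma> = 1 \<and> bc_mu \<Gamma> \<gamma> > 1})"
proof -
  interpret brauer_configuration \<Gamma> by (rule assms(1))
  note conn = assms(2)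
  have "vectorspace.fin_dim (class_ring :: 'k ring) (center_space \<Lambda>) \<and>
    vectorspace.dim (class_ring :: 'k ring) (center_space \<Lambda>) = card center_indices"
    unfolding assms(4) brauer_algebra_eq
    by (rule Lambda.dim_center_eq_card_of_dual_family[where b = central_elem and c = center_coord])
      (rule finite_center_indices central_elem_closed central_elem_central center_coord_add
        center_coord_smult center_coord_vanishes[OF conn] center_coord_dual[OF conn]
        center_coord_separating[OF conn]; assumption)+
  then show ?thesis by (simp add: card_center_indices)
qed

end
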